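(* Consider the conservative Allen–Cahn equation, i.e. let $\mathcal N$ be the RSLM or the BBLM nonlinearity defined in the context. Let $\mathcal W_{\mathfrak n}=U_{\mathfrak n}S_{\mathfrak n}V_{\mathfrak n}^\top$ be the coefficient matrix of $\boldsymbol w_h^{\mathfrak n}=\Phi(x)^\top U_{\mathfrak n}S_{\mathfrak n}V_{\mathfrak n}^\top\Psi(y)$, with $U_{\mathfrak n}^\top M_xU_{\mathfrak n}=V_{\mathfrak n}^\top M_yV_{\mathfrak n}=I_r$, and let $\mathcal W_{\mathfrak n+1}=U_{\mathfrak n+1}S_{\mathfrak n+1}V_{\mathfrak n+1}^\top$, $\boldsymbol w_h^{\mathfrak n+1}=\Phi(x)^\top\mathcal W_{\mathfrak n+1}\Psi(y)$, be the result of one step of the dynamical low-rank algorithm described in the context, with truncation tolerance $\eta$. Then mass is conserved up to the truncation tolerance: $$|(\boldsymbol w_h^{\mathfrak n+1}-\boldsymbol w_h^{\mathfrak n},1)_h|=|(\mathcal W_{\mathfrak n+1},\mathbf I)_{\rm M}-(\mathcal W_{\mathfrak n},\mathbf I)_{\rm M}|=|(U_{\mathfrak n+1}S_{\mathfrak n+1}V_{\mathfrak n+1}^\top,\mathbf I)_{\rm M}-(U_{\mathfrak n}S_{\mathfrak n}V_{\mathfrak n}^\top,\mathbf I)_{\rm M}|\le C\eta,$$ where $C>0$ is a constant independent of $\mathfrak n,\tau,h,\eta$.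
   Context: Discretization. $\Omega=[a,b]\times[c,d]$; $k,M,N\ge 1$ integers, $m=Mk+1$, $n=Nk+1$. $[a,b]$ is divided into $M$ equal subintervals and $[c,d]$ into $N$ equal subintervals; $h$ is the maximal mesh size; $x_1<\dots<x_m$ (resp. $y_1<\dots<y_n$) are the points obtained by placing the $(k+1)$-point Gauss–Lobatto points on every subinterval (shared endpoints counted once). $V_{x,h}^k$, $V_{y,h}^k$ are the spaces of continuous piecewise polynomials of degree $\le k$ on these partitions, $Q_h^k=V_{x,h}^k\otimes V_{y,h}^k$. $\{\phi_i\}_{i=1}^m$, $\{\psi_j\}_{j=1}^n$ are the Lagrange nodal bases ($\phi_i(x_l)=\delta_{il}$, $\psi_j(y_q)=\delta_{jq}$), $\Phi=[\phi_1,\dots,\phi_m]^\top$, $\Psi=[\psi_1,\dots,\psi_n]^\top$. $(f,g)_h$ denotes the composite (element by element) $(k+1)$-point (tensor-product) Gauss–Lobatto quadrature approximation of $\int fg$, in one or two dimensions. $M_x=[(\phi_i,\phi_j)_h]$, $M_y=[(\psi_i,\psi_j)_h]$ (diagonal), $A_x=[(\partial_x\phi_i,\partial_x\phi_j)_h]$, $A_y=[(\partial_y\psi_i,\partial_y\psi_j)_h]$, $L_x=-M_x^{-1}A_x$, $L_y=-M_y^{-1}A_y$. The coefficient matrix of $w_h\in Q_h^k$ is $W\in\mathbb R^{m\times n}$ with $w_h=\Phi(x)^\top W\Psi(y)$. $(A,B)_{\rm F}=\mathrm{tr}(A^\top B)$, $(A,B)_{\rm M}=(M_xAM_y,B)_{\rm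 F}$. $\mathbf I=q_mq_n^\top\in\mathbb R^{m\times n}$ is the all-ones matrix, $q_m\in\mathbb R^m,q_n\in\mathbb R^n$ all-ones vectors. $W^{\circ s}$ is the entrywise power. Nonlinearity. RSLM: $\mathcal N(W)=W-W^{\circ3}-\frac1{|\Omega|}(W-W^{\circ3},\mathbf I)_{\rm M}\,\mathbf I$. BBLM: $\mathcal N(W)=W-W^{\circ3}-\frac{(W-W^{\circ3},\mathbf I)_{\rm M}}{(\mathbf I-W^{\circ2},\mathbf I)_{\rm M}}(\mathbf I-W^{\circ2})$ (denominator nonzero wherever used). Algorithm (one step; $\epsilon>0$, time step $\tau>0$, tolerance $\eta\geq 0$). $\mathrm{GQR}(A,M)$ is a factorization $A=QR$ with $Q^\top MQ=I$; it returns $Q$ (and $R$). Input $U_{\mathfrak n}\in\mathbb R^{m\times r}$, $S_{\mathfrak n}\in\mathbb R^{r\times r}$, $V_{\mathfrak n}\in\mathbb R^{n\times r}$. (1) Linear step: $[U_{\mathfrak n,1},R]=\mathrm{GQR}(e^{\frac\tau2\epsilon^2L_x}U_{\mathfrak n},M_x)$, $[V_{\mathfrak n,1},P]=\mathrm{GQR}(e^{\frac\tau2\epsilon^2L_y}V_{\mathfrak n},M_y)$, $S_{\mathfrak n,1}=RS_{\mathfrak n}P^\top$, $\mathcal W_{\mathfrak n,1}=U_{\mathfrak n,1}S_{\mathfrak n,1}V_{\mathfrak n,1}^\top$. (2) First-order augmented BUG step: $K=U_{\mathfrak n,1}S_{\mathfrak n,1}+\tau\mathcal N(\mathcal W_{\mathfrak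 n,1})M_yV_{\mathfrak n,1}$, $L=V_{\mathfrak n,1}S_{\mathfrak n,1}^\top+\tau\mathcal N(\mathcal W_{\mathfrak n,1})^\top M_xU_{\mathfrak n,1}$; $U_{\mathfrak n,2}=\mathrm{GQR}([K,U_{\mathfrak n,1}],M_x)$, $V_{\mathfrak n,2}=\mathrm{GQR}([L,V_{\mathfrak n,1}],M_y)$; $S_*=(U_{\mathfrak n,2}^\top M_xU_{\mathfrak n,1})S_{\mathfrak n,1}(V_{\mathfrak n,2}^\top M_yV_{\mathfrak n,1})^\top$; $S_{\mathfrak n,2}=S_*+\tau U_{\mathfrak n,2}^\top M_x\mathcal N(U_{\mathfrak n,2}S_*V_{\mathfrak n,2}^\top)M_yV_{\mathfrak n,2}$; $\mathcal W_{\mathfrak n,2}=U_{\mathfrak n,2}S_{\mathfrak n,2}V_{\mathfrak n,2}^\top$. (3) Galerkin step: $\mathbb U=[q_m,U_{\mathfrak n,1},\tau\mathcal N(\mathcal W_{\mathfrak n,1})V_{\mathfrak n,1},\tau\mathcal N(\mathcal W_{\mathfrak n,2})V_{\mathfrak n,2}]$, $\mathbb V=[q_n,V_{\mathfrak n,1},\tau\mathcal N(\mathcal W_{\mathfrak n,1})^\top U_{\mathfrak n,1},\tau\mathcal N(\mathcal W_{\mathfrak n,2})^\top U_{\mathfrak n,2}]$; $\overline U_{\mathfrak n,3}=\mathrm{GQR}(\mathbb U,M_x)$, $\overline V_{\mathfrak n,3}=\mathrm{GQR}(\mathbb V,M_y)$ (with $\bar r\le4r+1$ columns); $\overline S_{\mathfrak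 n,1}=(\overline U_{\mathfrak n,3}^\top M_xU_{\mathfrak n,1})S_{\mathfrak n,1}(\overline V_{\mathfrak n,3}^\top M_yV_{\mathfrak n,1})^\top$; $\overline S_{\mathfrak n,2}=\overline S_{\mathfrak n,1}+\tau\overline U_{\mathfrak n,3}^\top M_x\mathcal N(\overline U_{\mathfrak n,3}\overline S_{\mathfrak n,1}\overline V_{\mathfrak n,3}^\top)M_y\overline V_{\mathfrak n,3}$; $\overline S_{\mathfrak n,3}=\frac12\overline S_{\mathfrak n,1}+\frac12\overline S_{\mathfrak n,2}+\frac\tau2\overline U_{\mathfrak n,3}^\top M_x\mathcal N(\overline U_{\mathfrak n,3}\overline S_{\mathfrak n,2}\overline V_{\mathfrak n,3}^\top)M_y\overline V_{\mathfrak n,3}$. (4) Truncation: SVD $\overline S_{\mathfrak n,3}=\overline R\,\overline\Sigma\,\overline P^\top$, $\overline\Sigma=\mathrm{diag}(\sigma_i)$ with $\sigma_i$ non-increasing; choose a rank $\tilde r$ (the original $r$ or a new one) with $\big(\sum_{i=\tilde r+1}^{\bar r}\sigma_i^2\big)^{1/2}\le\eta$; $S_{\mathfrak n,3}=\mathrm{diag}(\sigma_1,\dots,\sigma_{\tilde r})$, $U_{\mathfrak n,3}=\overline U_{\mathfrak n,3}R'$, $V_{\mathfrak n,3}=\overline V_{\mathfrak n,3}P'$ where $R',P'$ are the first $\tilde r$ columns of $\overline R,\overline P$. (5) Linear step: apply (1) to $(U_{\mathfrak n,3},S_{\mathfrak n,3},V_{\mathfrak n,3})$ to get $(U_{\mathfrak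 n+1},S_{\mathfrak n+1},V_{\mathfrak n+1})$. *)

theory Defs
  imports "HOL-Analysis.Analysis" "Jordan_Normal_Form.Gauss_Jordan_Elimination"
begin

hide_const (open) Finite_Cartesian_Product.mat Finite_Cartesian_Product.vec
hide_const (open) Finite_Cartesian_Product.row Determinants.trace

section \<open>Gauss--Lobatto quadrature and finite elements in one dimension\<close>

text \<open>
  The \<open>(k+1)\<close>-point Gauss--Lobatto rule on \<open>[-1,1]\<close>: both endpoints are nodes, and the remaining
  nodes and the weights are such that the rule has the maximal degree of exactness \<open>2k-1\<close>.
  For \<open>k \<ge> 1\<close> this determines \<open>\<xi> 0 < \<dots> < \<xi> k\<close> and \<open>\<omega> 0, \<dots>, \<omega> k\<close> uniquely
  (the interior nodes are the zeros of the derivative of the \<open>k\<close>-th Legendre polynomial).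
\<close>

definition gauss_lobatto :: "nat \<Rightarrow> (nat \<Rightarrow> real) \<Rightarrow> (nat \<Rightarrow> real) \<Rightarrow> bool" where
  "gauss_lobatto k \<xi> \<omega> \<longleftrightarrow>
     strict_mono_on {..k} \<xi> \<and> \<xi> 0 = -1 \<and> \<xi> k = 1 \<and>
     (\<forall>p :: real poly. degree p < 2 * k \<longrightarrow>
        (\<Sum>j\<le>k. \<omega> j * poly p (\<xi> j)) = integral {-1..1} (poly p))"

text \<open>
  Everything is indexed from 0: cells \<open>e < M\<close>, local nodes \<open>j \<le> k\<close>, global nodes \<open>l < M * k + 1\<close>.
\<close>

definition mesh_size :: "real \<Rightarrow> real \<Rightarrow> nat \<Rightarrow> real" where
  "mesh_size a b M = (b - a) / real M"

definition cell :: "real \<Rightarrow> real \<Rightarrow> nat \<Rightarrow> nat \<Rightarrow> real set" where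
  "cell a b M e = {a + real e * mesh_size a b M .. a + real (Suc e) * mesh_size a b M}"

definition cell_node :: "(nat \<Rightarrow> real) \<Rightarrow> real \<Rightarrow> real \<Rightarrow> nat \<Rightarrow> nat \<Rightarrow> nat \<Rightarrow> real" where
  "cell_node \<xi> a b M e j = a + (real e + (1 + \<xi> j) / 2) * mesh_size a b M"

text \<open>
  Local node \<open>k\<close> of cell \<open>e\<close> coincides with local node \<open>0\<close> of cell \<open>e + 1\<close>; it is counted once,
  with global number \<open>(e + 1) * k\<close>.  The last global node \<open>l = M * k\<close> is the right endpoint \<open>b\<close>.
\<close>

definition grid_node :: "nat \<Rightarrow> (nat \<Rightarrow> real) \<Rightarrow> real \<Rightarrow> real \<Rightarrow> nat \<Rightarrow> nat \<Rightarrow> real" where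
  "grid_node k \<xi> a b M l = cell_node \<xi> a b M (l div k) (l mod k)"

definition pw_poly_space :: "nat \<Rightarrow> real \<Rightarrow> real \<Rightarrow> nat \<Rightarrow> (real \<Rightarrow> real) set" where
  "pw_poly_space k a b M =
     {f. continuous_on {a..b} f \<and>
         (\<forall>e<M. \<exists>p :: real poly. degree p \<le> k \<and> (\<forall>x\<in>cell a b M e. f x = poly p x))}"

definition nodal_basis ::
    "nat \<Rightarrow> (nat \<Rightarrow> real) \<Rightarrow> real \<Rightarrow> real \<Rightarrow> nat \<Rightarrow> (nat \<Rightarrow> real \<Rightarrow> real) \<Rightarrow> bool" where
  "nodal_basis k \<xi> a b M \<phi> \<longleftrightarrow>
     (\<forall>i < M * k + 1. \<phi> i \<in> pw_poly_space k a b M \<and>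
        (\<forall>l < M * k + 1. \<phi> i (grid_node k \<xi> a b M l) = (if i = l then 1 else 0)))"

text \<open>
  The composite quadrature is evaluated cell by cell, so its arguments are families
  \<open>e \<mapsto> f|\<^sub>e\<close> of functions indexed by the cells.  This matters for derivatives of
  piecewise polynomials, which are two-valued at the interfaces: on each cell the (at the cell
  ends one-sided) derivative relative to that cell is used.
\<close>

definition quad1 ::
    "nat \<Rightarrow> (nat \<Rightarrow> real) \<Rightarrow> (nat \<Rightarrow> real) \<Rightarrow> real \<Rightarrow> real \<Rightarrow> nat \<Rightarrow>
      (nat \<Rightarrow> real \<Rightarrow> real) \<Rightarrow> (nat \<Rightarrow> real \<Rightarrow> real) \<Rightarrow> real" where
  "quad1 k \<xi> \<omega> a b M f g =
     (\<Sum>e<M. \<Sum>j\<le>k. mesh_size a b M / 2 * \<omega> j *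
        (f e (cell_node \<xi> a b M e j) * g e (cell_node \<xi> a b M e j)))"

definition cell_deriv :: "real \<Rightarrow> real \<Rightarrow> nat \<Rightarrow> (real \<Rightarrow> real) \<Rightarrow> nat \<Rightarrow> real \<Rightarrow> real" where
  "cell_deriv a b M f e x = vector_derivative f (at x within cell a b M e)"

definition mass_matrix ::
    "nat \<Rightarrow> (nat \<Rightarrow> real) \<Rightarrow> (nat \<Rightarrow> real) \<Rightarrow> real \<Rightarrow> real \<Rightarrow> nat \<Rightarrow> (nat \<Rightarrow> real \<Rightarrow> real) \<Rightarrow> real mat" where
  "mass_matrix k \<xi> \<omega> a b M \<phi> =
     Matrix.mat (M * k + 1) (M * k + 1)
       (\<lambda>(i, j). quad1 k \<xi> \<omega> a b M (\<lambda>_. \<phi> i) (\<lambda>_. \<phi> j))"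

definition stiffness_matrix ::
    "nat \<Rightarrow> (nat \<Rightarrow> real) \<Rightarrow> (nat \<Rightarrow> real) \<Rightarrow> real \<Rightarrow> real \<Rightarrow> nat \<Rightarrow> (nat \<Rightarrow> real \<Rightarrow> real) \<Rightarrow> real mat" where
  "stiffness_matrix k \<xi> \<omega> a b M \<phi> =
     Matrix.mat (M * k + 1) (M * k + 1)
       (\<lambda>(i, j). quad1 k \<xi> \<omega> a b M (cell_deriv a b M (\<phi> i)) (cell_deriv a b M (\<phi> j)))"

definition discrete_laplacian ::
    "nat \<Rightarrow> (nat \<Rightarrow> real) \<Rightarrow> (nat \<Rightarrow> real) \<Rightarrow> real \<Rightarrow> real \<Rightarrow> nat \<Rightarrow> (nat \<Rightarrow> real \<Rightarrow> real) \<Rightarrow> real mat" where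
  "discrete_laplacian k \<xi> \<omega> a b M \<phi> =
     - (the (mat_inverse (mass_matrix k \<xi> \<omega> a b M \<phi>)) * stiffness_matrix k \<xi> \<omega> a b M \<phi>)"


section \<open>The two-dimensional setting\<close>

definition quad2 ::
    "nat \<Rightarrow> (nat \<Rightarrow> real) \<Rightarrow> (nat \<Rightarrow> real) \<Rightarrow> real \<Rightarrow> real \<Rightarrow> nat \<Rightarrow> real \<Rightarrow> real \<Rightarrow> nat \<Rightarrow>
      (real \<Rightarrow> real \<Rightarrow> real) \<Rightarrow> (real \<Rightarrow> real \<Rightarrow> real) \<Rightarrow> real" where
  "quad2 k \<xi> \<omega> a b M c d N f g =
     (\<Sum>e<M. \<Sum>e'<N. \<Sum>i\<le>k. \<Sum>j\<le>k.
        (mesh_size a b M / 2 * \<omega> i) * (mesh_size c d N / 2 * \<omega> j) *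
        (f (cell_node \<xi> a b M e i) (cell_node \<xi> c d N e' j) *
         g (cell_node \<xi> a b M e i) (cell_node \<xi> c d N e' j)))"

definition fe_function ::
    "(nat \<Rightarrow> real \<Rightarrow> real) \<Rightarrow> (nat \<Rightarrow> real \<Rightarrow> real) \<Rightarrow> real mat \<Rightarrow> real \<Rightarrow> real \<Rightarrow> real" where
  "fe_function \<phi> \<psi> W x y =
     scalar_prod (Matrix.vec (dim_row W) (\<lambda>i. \<phi> i x))
       (W *\<^sub>v Matrix.vec (dim_col W) (\<lambda>j. \<psi> j y))"

definition frob_inner :: "real mat \<Rightarrow> real mat \<Rightarrow> real" where
  "frob_inner A B = (\<Sum>i<dim_col B. (transpose_mat A * B) $$ (i, i))"

definition mass_inner :: "real mat \<Rightarrow> real mat \<Rightarrow> real mat \<Rightarrow> real mat \<Rightarrow> real" where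
  "mass_inner Mx My A B = frob_inner (Mx * A * My) B"

definition ones_vec :: "nat \<Rightarrow> real Matrix.vec" where
  "ones_vec m = Matrix.vec m (\<lambda>_. 1)"

definition ones_mat :: "nat \<Rightarrow> nat \<Rightarrow> real mat" where
  "ones_mat m n = Matrix.mat m n (\<lambda>_. 1)"

definition entry_pow :: "real mat \<Rightarrow> nat \<Rightarrow> real mat" where
  "entry_pow W s = map_mat (\<lambda>w. w ^ s) W"


section \<open>Conservative Allen--Cahn nonlinearities\<close>

datatype nonlinearity = RSLM | BBLM

fun nonlin :: "nonlinearity \<Rightarrow> real \<Rightarrow> real mat \<Rightarrow> real mat \<Rightarrow> real mat \<Rightarrow> real mat" where
  "nonlin RSLM area Mx My W =
     (let I = ones_mat (dim_row W) (dim_col W); F = W - entry_pow W 3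
      in F - (1 / area * mass_inner Mx My F I) \<cdot>\<^sub>m I)"
| "nonlin BBLM area Mx My W =
     (let I = ones_mat (dim_row W) (dim_col W); F = W - entry_pow W 3; G = I - entry_pow W 2
      in F - (mass_inner Mx My F I / mass_inner Mx My G I) \<cdot>\<^sub>m G)"

fun nonlin_defined :: "nonlinearity \<Rightarrow> real mat \<Rightarrow> real mat \<Rightarrow> real mat \<Rightarrow> bool" where
  "nonlin_defined RSLM Mx My W \<longleftrightarrow> True"
| "nonlin_defined BBLM Mx My W \<longleftrightarrow>
     (let I = ones_mat (dim_row W) (dim_col W) in mass_inner Mx My (I - entry_pow W 2) I \<noteq> 0)"


section \<open>The dynamical low-rank algorithm\<close>

definition mat_exp :: "real mat \<Rightarrow> real mat" where
  "mat_exp A = Matrix.mat (dim_row A) (dim_row A) (\<lambda>(i, j). \<Sum>l. (A ^\<^sub>m l) $$ (i, j) / fact l)"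

definition hcat :: "nat \<Rightarrow> real mat list \<Rightarrow> real mat" where
  "hcat m As = mat_of_cols m (concat (map cols As))"

text \<open>
  An outcome \<open>(Q, R)\<close> of a generalised QR factorisation.  The factor \<open>Q\<close> has at most as many
  columns as \<open>A\<close>; it may have fewer when \<open>A\<close> is rank deficient.  Since the factorisation is not
  unique, the algorithm below is a relation between its input and its possible outputs.
\<close>

definition gqr :: "real mat \<Rightarrow> real mat \<Rightarrow> real mat \<Rightarrow> real mat \<Rightarrow> bool" where
  "gqr A Mm Q R \<longleftrightarrow>
     (\<exists>s \<le> dim_col A. Q \<in> carrier_mat (dim_row A) s \<and> R \<in> carrier_mat s (dim_col A) \<and>
        A = Q * R \<and> transpose_mat Q * Mm * Q = 1\<^sub>m s)"

text \<open>The parameter \<open>t\<close> stands for \<open>\<tau>/2 \<cdot> \<epsilon>\<^sup>2\<close>.\<close>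

definition linear_step ::
    "real \<Rightarrow> real mat \<Rightarrow> real mat \<Rightarrow> real mat \<Rightarrow> real mat \<Rightarrow>
      real mat \<Rightarrow> real mat \<Rightarrow> real mat \<Rightarrow> real mat \<Rightarrow> real mat \<Rightarrow> real mat \<Rightarrow> bool" where
  "linear_step t Mx My Lx Ly U S V U' S' V' \<longleftrightarrow>
     (\<exists>R P. gqr (mat_exp (t \<cdot>\<^sub>m Lx) * U) Mx U' R \<and>
            gqr (mat_exp (t \<cdot>\<^sub>m Ly) * V) My V' P \<and>
            S' = R * S * transpose_mat P)"

text \<open>
  In the next two steps \<open>nonlin_defined\<close> is required of every argument at which the nonlinearity
  is evaluated.
\<close>

definition bug_step ::
    "nonlinearity \<Rightarrow> real \<Rightarrow> real \<Rightarrow> real mat \<Rightarrow> real mat \<Rightarrow>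
      real mat \<Rightarrow> real mat \<Rightarrow> real mat \<Rightarrow> real mat \<Rightarrow> real mat \<Rightarrow> real mat \<Rightarrow> bool" where
  "bug_step nl area \<tau> Mx My U1 S1 V1 U2 S2 V2 \<longleftrightarrow>
     (let \<N> = nonlin nl area Mx My;
          W1 = U1 * S1 * transpose_mat V1;
          K = U1 * S1 + \<tau> \<cdot>\<^sub>m (\<N> W1 * My * V1);
          L = V1 * transpose_mat S1 + \<tau> \<cdot>\<^sub>m (transpose_mat (\<N> W1) * Mx * U1);
          S' = (transpose_mat U2 * Mx * U1) * S1 * transpose_mat (transpose_mat V2 * My * V1);
          W' = U2 * S' * transpose_mat V2
      in nonlin_defined nl Mx My W1 \<and>
         (\<exists>R. gqr (hcat (dim_row U1) [K, U1]) Mx U2 R) \<and>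
         (\<exists>R. gqr (hcat (dim_row V1) [L, V1]) My V2 R) \<and>
         nonlin_defined nl Mx My W' \<and>
         S2 = S' + \<tau> \<cdot>\<^sub>m (transpose_mat U2 * Mx * \<N> W' * My * V2))"

definition galerkin_step ::
    "nonlinearity \<Rightarrow> real \<Rightarrow> real \<Rightarrow> real mat \<Rightarrow> real mat \<Rightarrow>
      real mat \<Rightarrow> real mat \<Rightarrow> real mat \<Rightarrow> real mat \<Rightarrow> real mat \<Rightarrow> real mat \<Rightarrow>
      real mat \<Rightarrow> real mat \<Rightarrow> real mat \<Rightarrow> bool" where
  "galerkin_step nl area \<tau> Mx My U1 S1 V1 U2 S2 V2 Ub Sb Vb \<longleftrightarrow>
     (let \<N> = nonlin nl area Mx My;
          m = dim_row U1; n = dim_row V1;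
          W1 = U1 * S1 * transpose_mat V1;
          W2 = U2 * S2 * transpose_mat V2;
          UU = hcat m [mat_of_cols m [ones_vec m], U1,
                 \<tau> \<cdot>\<^sub>m (\<N> W1 * V1), \<tau> \<cdot>\<^sub>m (\<N> W2 * V2)];
          VV = hcat n [mat_of_cols n [ones_vec n], V1,
                 \<tau> \<cdot>\<^sub>m (transpose_mat (\<N> W1) * U1), \<tau> \<cdot>\<^sub>m (transpose_mat (\<N> W2) * U2)];
          Sb1 = (transpose_mat Ub * Mx * U1) * S1 * transpose_mat (transpose_mat Vb * My * V1);
          Wb1 = Ub * Sb1 * transpose_mat Vb;
          Sb2 = Sb1 + \<tau> \<cdot>\<^sub>m (transpose_mat Ub * Mx * \<N> Wb1 * My * Vb);
          Wb2 = Ub * Sb2 * transpose_mat Vb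
      in nonlin_defined nl Mx My W1 \<and> nonlin_defined nl Mx My W2 \<and>
         (\<exists>R. gqr UU Mx Ub R) \<and> (\<exists>R. gqr VV My Vb R) \<and>
         nonlin_defined nl Mx My Wb1 \<and> nonlin_defined nl Mx My Wb2 \<and>
         Sb = (1/2) \<cdot>\<^sub>m Sb1 + (1/2) \<cdot>\<^sub>m Sb2
            + (\<tau>/2) \<cdot>\<^sub>m (transpose_mat Ub * Mx * \<N> Wb2 * My * Vb))"

text \<open>
  \<open>Ub\<close> and \<open>Vb\<close> are allowed to have different numbers of columns, in which case \<open>Sb\<close> is
  rectangular; in the square case this is the usual SVD with \<open>Sb = R diag(\<sigma>) P\<^sup>T\<close>.
\<close>

definition is_svd :: "real mat \<Rightarrow> real mat \<Rightarrow> (nat \<Rightarrow> real) \<Rightarrow> real mat \<Rightarrow> bool" where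
  "is_svd A R \<sigma> P \<longleftrightarrow>
     (let p = dim_row A; q = dim_col A in
        R \<in> carrier_mat p p \<and> transpose_mat R * R = 1\<^sub>m p \<and>
        P \<in> carrier_mat q q \<and> transpose_mat P * P = 1\<^sub>m q \<and>
        (\<forall>i < min p q. 0 \<le> \<sigma> i) \<and> (\<forall>i j. i \<le> j \<and> j < min p q \<longrightarrow> \<sigma> j \<le> \<sigma> i) \<and>
        A = R * Matrix.mat p q (\<lambda>(i, j). if i = j then \<sigma> i else 0) * transpose_mat P)"

definition first_cols :: "nat \<Rightarrow> real mat \<Rightarrow> real mat" where
  "first_cols s A = mat_of_cols (dim_row A) (take s (cols A))"

definition truncation ::
    "real \<Rightarrow> real mat \<Rightarrow> real mat \<Rightarrow> real mat \<Rightarrow> real mat \<Rightarrow> real mat \<Rightarrow> real mat \<Rightarrow> bool" where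
  "truncation \<eta> Ub Sb Vb U S V \<longleftrightarrow>
     (\<exists>R \<sigma> P. \<exists>s \<le> min (dim_row Sb) (dim_col Sb).
        is_svd Sb R \<sigma> P \<and>
        sqrt (\<Sum>i = s..<min (dim_row Sb) (dim_col Sb). (\<sigma> i)\<^sup>2) \<le> \<eta> \<and>
        S = mat_diag s \<sigma> \<and> U = Ub * first_cols s R \<and> V = Vb * first_cols s P)"

definition dlr_step ::
    "nonlinearity \<Rightarrow> real \<Rightarrow> real \<Rightarrow> real \<Rightarrow> real \<Rightarrow>
      real mat \<Rightarrow> real mat \<Rightarrow> real mat \<Rightarrow> real mat \<Rightarrow>
      real mat \<Rightarrow> real mat \<Rightarrow> real mat \<Rightarrow> real mat \<Rightarrow> real mat \<Rightarrow> real mat \<Rightarrow> bool" where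
  "dlr_step nl area \<epsilon> \<tau> \<eta> Mx My Lx Ly U S V U' S' V' \<longleftrightarrow>
     (\<exists>U1 S1 V1 U2 S2 V2 Ub Sb Vb U3 S3 V3.
        linear_step (\<tau> / 2 * \<epsilon>\<^sup>2) Mx My Lx Ly U S V U1 S1 V1 \<and>
        bug_step nl area \<tau> Mx My U1 S1 V1 U2 S2 V2 \<and>
        galerkin_step nl area \<tau> Mx My U1 S1 V1 U2 S2 V2 Ub Sb Vb \<and>
        truncation \<eta> Ub Sb Vb U3 S3 V3 \<and>
        linear_step (\<tau> / 2 * \<epsilon>\<^sup>2) Mx My Lx Ly U3 S3 V3 U' S' V')"

end

theory Submission
  imports Defs "Jordan_Normal_Form.Determinant"
begin

text \<open>
  Write \<open>q\<close> for a vector of ones.  The discrete mass of a coefficient matrix \<open>W\<close> is the bilinear form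
  \<open>u\<^sup>T W v\<close> in the vectors of nodal quadrature weights \<open>u = M\<^sub>x q\<close> and \<open>v = M\<^sub>y q\<close> (\<open>mass_inner_ones\<close>); it is
  also the quadrature of the finite element function (\<open>quad2_fe_function\<close>).  In each part of the step it
  suffices to see what happens to \<open>u\<close> and \<open>v\<close> when the outer factors of a product act on them.

  The linear steps multiply \<open>W\<close> by \<open>exp (t L\<^sub>x)\<close> and \<open>exp (t L\<^sub>y)\<^sup>T\<close>.  The basis functions sum to one, so \<open>q\<close> is
  in the kernel of the stiffness matrix, \<open>L\<^sub>x\<^sup>T u = 0\<close>, and the exponentials leave \<open>u\<close> and \<open>v\<close> fixed
  (\<open>transpose_laplacian_mass_ones\<close>, \<open>linear_step_total\<close>).  This presupposes that the mass matrix is invertible,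
  which holds because the Gauss--Lobatto weights are positive (\<open>gauss_lobatto_weight_pos\<close>).

  The Galerkin step projects onto spaces that contain \<open>q\<close> because the bases are augmented by it.
  Projecting therefore preserves mass, and both nonlinearities have mass zero
  (\<open>total_nonlin\<close>, \<open>galerkin_step_total\<close>).

  Only the truncation changes the mass.  In Galerkin coefficients the test vectors are \<open>U\<^sup>T u\<close> and \<open>V\<^sup>T v\<close>, where
  \<open>U\<close> and \<open>V\<close> are the augmented bases.  As \<open>U U\<^sup>T u = q\<close>, the squared norm of the first is \<open>u\<^sup>T q = b - a\<close>; that
  of the second is \<open>d - c\<close>.  The discarded singular values have Euclidean norm at most \<open>\<eta>\<close>, so the
  Cauchy--Schwarz inequality bounds the change by \<open>sqrt ((b - a) * (d - c)) * \<eta>\<close>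
  (\<open>truncation_form_error\<close>, \<open>truncation_total\<close>).  The constant is the square root of the area of the
  domain, hence independent of the mesh, the time step, the rank and the tolerance.
\<close>

section \<open>The Gauss--Lobatto rule\<close>

lemma gauss_lobatto_exact:
  assumes "gauss_lobatto k \<xi> \<omega>" "degree p < 2 * k"
  shows "(\<Sum>j\<le>k. \<omega> j * poly p (\<xi> j)) = integral {-1..1} (poly p)"
  using assms unfolding gauss_lobatto_def by blast

lemma gauss_lobatto_weights_sum:
  assumes "gauss_lobatto k \<xi> \<omega>" "k \<ge> 1"
  shows "(\<Sum>j\<le>k. \<omega> j) = 2"
proof -
  have "poly (1 :: real poly) = (\<lambda>_. 1)" by auto
  then show ?thesis
    using gauss_lobatto_exact[OF assms(1), of 1] assms(2) by simp
qed

lemma gauss_lobatto_nodes_inj: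
  assumes "gauss_lobatto k \<xi> \<omega>" "i \<le> k" "j \<le> k" "\<xi> i = \<xi> j"
  shows "i = j"
  using assms strict_mono_on_imp_inj_on unfolding gauss_lobatto_def inj_on_def by blast

lemma gauss_lobatto_node_bounds:
  assumes gl: "gauss_lobatto k \<xi> \<omega>" and j: "j \<le> k"
  shows "-1 \<le> \<xi> j" "\<xi> j \<le> 1"
proof -
  have m: "mono_on {..k} \<xi>"
    using gl strict_mono_on_imp_mono_on unfolding gauss_lobatto_def by blast
  show "-1 \<le> \<xi> j" "\<xi> j \<le> 1"
    using monotone_onD[OF m, of 0 j] monotone_onD[OF m, of j k] gl j
    unfolding gauss_lobatto_def by auto
qed

text \<open>Exactness is tested on a polynomial that is nonnegative on \<open>[-1,1]\<close> and vanishes at every node except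
  the \<open>j\<close>-th: its integral is positive and equals \<open>\<omega> j\<close> times a positive value.  The square of the
  Lagrange polynomial would have degree \<open>2k\<close>, one too many.  The end nodes lie on the boundary of the
  interval, so simple linear factors suffice there, and the degree drops below \<open>2k\<close>.\<close>

lemma gauss_lobatto_weight_pos:
  assumes gl: "gauss_lobatto k \<xi> \<omega>" and k: "k \<ge> 1" and j: "j \<le> k"
  shows "\<omega> j > 0"
proof -
  define s where "s = (\<Prod>i\<in>{1..<k} - {j}. [:- \<xi> i, 1:])"
  define p where "p = (if j = 0 then 1 else [:1, 1:]) * (if j = k then 1 else [:1, -1:]) * s ^ 2"
  have inj: "\<xi> i = \<xi> l \<longleftrightarrow> i = l" if "i \<le> k" "l \<le> k" for i l
    using gauss_lobatto_nodes_inj[OF gl that] by auto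
  have ends: "\<xi> 0 = -1" "\<xi> k = 1"
    using gl unfolding gauss_lobatto_def by auto
  have s_eval: "poly s x = 0 \<longleftrightarrow> (\<exists>i\<in>{1..<k} - {j}. x = \<xi> i)" for x
    by (auto simp: s_def poly_prod)
  have deg_s: "degree s = card ({1..<k} - {j})"
    unfolding s_def by (subst degree_prod_eq_sum_degree) auto
  have deg: "degree p < 2 * k"
  proof -
    \<comment> \<open>Each end node other than \<open>j\<close> costs one degree, each interior node other than \<open>j\<close> costs two.\<close>
    have "degree p \<le> degree (if j = 0 then 1 else [:1, 1 :: real:])
        + degree (if j = k then 1 else [:1, -1 :: real:]) + degree (s ^ 2)"
      unfolding p_def by (meson add_le_mono1 degree_mult_le order.trans)
    also have "\<dots> \<le> (if j = 0 then 0 else 1) + (if j = k then 0 else 1) + 2 * degree s"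
      using degree_power_le[of s 2] by (auto simp: mult.commute)
    also have "\<dots> < 2 * k"
    proof -
      consider "j = 0" | "j = k" | "1 \<le> j" "j < k" using j by linarith
      then show ?thesis
      proof cases
        assume "1 \<le> j" "j < k"
        then have "card ({1..<k} - {j}) = k - 2" by simp
        with \<open>1 \<le> j\<close> \<open>j < k\<close> show ?thesis unfolding deg_s by auto
      qed (use k in \<open>auto simp: deg_s\<close>)
    qed
    finally show ?thesis .
  qed
  have nonneg: "0 \<le> poly p x" if "x \<in> {-1..1}" for x
    using that by (auto simp: p_def)
  have vanish: "poly p (\<xi> l) = 0" if l: "l \<le> k" "l \<noteq> j" for l
  proof -
    consider "l = 0" | "l = k" | "l \<in> {1..<k} - {j}" using l by fastforce
    then show ?thesis
      using l ends s_eval[of "\<xi> l"] by cases (auto simp: p_def)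
  qed
  have at_j: "poly p (\<xi> j) \<noteq> 0"
    using inj[of j 0] inj[of j k] ends j s_eval[of "\<xi> j"] inj[of j]
    by (auto simp: p_def)
  have xj: "\<xi> j \<in> {-1..1}"
    using gauss_lobatto_node_bounds[OF gl j] by auto
  have cont: "continuous_on {-1..1} (poly p)"
    by (intro continuous_intros)
  have "integral {-1..1} (poly p) \<noteq> 0"
  proof
    assume "integral {-1..1} (poly p) = 0"
    then have "\<forall>x\<in>{-1..1}. poly p x = 0"
      using integral_eq_0_iff[of "-1" 1 "poly p"] nonneg cont by simp
    then show False using at_j xj by blast
  qed
  moreover have "integral {-1..1} (poly p) \<ge> 0"
    by (intro integral_nonneg nonneg integrable_continuous_real cont) auto
  moreover have "integral {-1..1} (poly p) = (\<Sum>l\<le>k. \<omega> l * poly p (\<xi> l))"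
    using gauss_lobatto_exact[OF gl deg] by simp
  moreover have "\<dots> = \<omega> j * poly p (\<xi> j)"
    using j vanish by (subst sum.remove[of _ j]) (auto intro!: sum.neutral)
  ultimately have "\<omega> j * poly p (\<xi> j) > 0" by linarith
  with nonneg[OF xj] show ?thesis
    by (simp add: zero_less_mult_iff)
qed

section \<open>Mass and stiffness matrices on an interval\<close>

lemma ones_vec_carrier: "ones_vec l \<in> carrier_vec l"
  by (simp add: ones_vec_def)

locale lobatto_mesh =
  fixes k :: nat and \<xi> \<omega> :: "nat \<Rightarrow> real" and a b :: real and M :: nat
    and \<phi> :: "nat \<Rightarrow> real \<Rightarrow> real"
  assumes rule: "gauss_lobatto k \<xi> \<omega>" and degree_pos: "k \<ge> 1"
    and interval: "a < b" and cells: "M \<ge> 1"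
    and basis: "nodal_basis k \<xi> a b M \<phi>"
begin

abbreviation "dofs \<equiv> M * k + 1"
abbreviation "node \<equiv> cell_node \<xi> a b M"
abbreviation "mass \<equiv> mass_matrix k \<xi> \<omega> a b M \<phi>"
abbreviation "stiffness \<equiv> stiffness_matrix k \<xi> \<omega> a b M \<phi>"
abbreviation "laplacian \<equiv> discrete_laplacian k \<xi> \<omega> a b M \<phi>"
abbreviation "node_weight j \<equiv> mesh_size a b M / 2 * \<omega> j"

lemma mesh_size_pos: "mesh_size a b M > 0"
  using interval cells by (simp add: mesh_size_def)

lemma node_weight_pos: "j \<le> k \<Longrightarrow> node_weight j > 0"
  using gauss_lobatto_weight_pos[OF rule degree_pos] mesh_size_pos by simp

text \<open>The case \<open>j = k\<close> is the interface point: it is numbered as local node \<open>0\<close> of the next cell, also on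
  the last cell, where that next cell lies outside the mesh.\<close>

lemma node_eq_grid_node:
  assumes "j \<le> k"
  shows "node e j = grid_node k \<xi> a b M (e * k + j)"
proof (cases "j = k")
  case True
  have "\<xi> 0 = -1" "\<xi> k = 1" using rule by (auto simp: gauss_lobatto_def)
  moreover have "(e * k + k) div k = Suc e" "(e * k + k) mod k = 0"
    using degree_pos by auto
  ultimately show ?thesis
    using True by (simp add: grid_node_def cell_node_def)
next
  case False
  then show ?thesis
    using assms by (simp add: grid_node_def)
qed

lemma node_index_less:
  assumes "e < M" "j \<le> k"
  shows "e * k + j < dofs"
proof -
  have "e * k + k \<le> M * k"
    using assms(1) mult_le_mono1[of "Suc e" M k] by simp
  then show ?thesis using assms(2) by simp
qed

text \<open>The quadrature nodes are the interpolation nodes, which is what makes the mass matrix diagonal.\<close>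

lemma basis_at_node:
  assumes "i < dofs" "e < M" "j \<le> k"
  shows "\<phi> i (node e j) = (if i = e * k + j then 1 else 0)"
  using basis assms node_index_less[of e j] node_eq_grid_node[of j e]
  unfolding nodal_basis_def by auto

lemma dof_is_node:
  assumes "i < dofs"
  obtains e j where "e < M" "j \<le> k" "i = e * k + j"
proof (cases "i < M * k")
  case True
  show ?thesis
  proof (rule that)
    show "i div k < M" using True by (simp add: less_mult_imp_div_less)
    show "i mod k \<le> k" using degree_pos by (simp add: less_imp_le)
  qed simp
next
  case False
  show ?thesis
  proof (rule that)
    show "M - 1 < M" using cells by simp
    have "(M - 1) * k + k = M * k" using cells by (cases M) auto
    then show "i = (M - 1) * k + k" using False assms by simp
  qed simp
qed

lemma node_in_cell:
  assumes "j \<le> k"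
  shows "node e j \<in> cell a b M e"
proof -
  have "0 \<le> (1 + \<xi> j) / 2" "(1 + \<xi> j) / 2 \<le> 1"
    using gauss_lobatto_node_bounds[OF rule assms] by auto
  then show ?thesis
    using mesh_size_pos by (auto simp: cell_node_def cell_def intro!: mult_right_mono)
qed

lemma mass_carrier: "mass \<in> carrier_mat dofs dofs"
  by (simp add: mass_matrix_def)

lemma stiffness_carrier: "stiffness \<in> carrier_mat dofs dofs"
  by (simp add: stiffness_matrix_def)

lemma transpose_mass: "transpose_mat mass = mass"
  by (rule eq_matI) (auto simp: mass_matrix_def quad1_def mult.commute)

lemma transpose_stiffness: "transpose_mat stiffness = stiffness"
  by (rule eq_matI) (auto simp: stiffness_matrix_def quad1_def mult.commute)

lemma partition_of_unity_at_node:
  assumes "e < M" "j \<le> k"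
  shows "(\<Sum>i<dofs. \<phi> i (node e j)) = 1"
  using assms node_index_less[OF assms] by (simp add: basis_at_node)

lemma pderiv_sum: "pderiv (\<Sum>i\<in>I. p i) = (\<Sum>i\<in>I. pderiv (p i))"
  by (induction I rule: infinite_finite_induct) (simp_all add: pderiv_add)

text \<open>On a cell the basis functions sum to a polynomial of degree at most \<open>k\<close> that equals one at
  \<open>k + 1\<close> points, hence to the constant one; differentiating gives the claim.\<close>

lemma sum_cell_deriv_basis:
  assumes e: "e < M" and j: "j \<le> k"
  shows "(\<Sum>i<dofs. cell_deriv a b M (\<phi> i) e (node e j)) = 0"
proof -
  have "\<forall>i<dofs. \<exists>p :: real poly. degree p \<le> k \<and> (\<forall>x\<in>cell a b M e. \<phi> i x = poly p x)"
    using basis e unfolding nodal_basis_def pw_poly_space_def by blast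
  then obtain p :: "nat \<Rightarrow> real poly" where p: "\<And>i. i < dofs \<Longrightarrow> degree (p i) \<le> k"
      "\<And>i x. i < dofs \<Longrightarrow> x \<in> cell a b M e \<Longrightarrow> \<phi> i x = poly (p i) x"
    by metis
  have deriv: "cell_deriv a b M (\<phi> i) e (node e j) = poly (pderiv (p i)) (node e j)" if i: "i < dofs" for i
  proof -
    have "(poly (p i) has_vector_derivative poly (pderiv (p i)) (node e j))
        (at (node e j) within cell a b M e)"
      by (metis has_field_derivative_at_within has_real_derivative_iff_has_vector_derivative poly_DERIV)
    then have "(\<phi> i has_vector_derivative poly (pderiv (p i)) (node e j))
        (at (node e j) within cell a b M e)"
      by (rule has_vector_derivative_transform[OF node_in_cell[OF j], rotated]) (simp add: p(2)[OF i])
    moreover have "a + real e * mesh_size a b M < a + real (Suc e) * mesh_size a b M"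
      using mesh_size_pos by (simp add: algebra_simps)
    ultimately show ?thesis
      using node_in_cell[OF j, of e] unfolding cell_deriv_def cell_def
      by (intro vector_derivative_within_closed_interval) auto
  qed
  have "(\<Sum>i<dofs. p i) = 1"
  proof (rule poly_eqI_degree)
    fix x assume "x \<in> node e ` {..k}"
    then obtain l where l: "l \<le> k" "x = node e l" by auto
    then show "poly (\<Sum>i<dofs. p i) x = poly 1 x"
      using partition_of_unity_at_node[OF e l(1)] p(2)[OF _ node_in_cell[OF l(1)]]
      by (simp add: poly_sum)
  next
    have "inj_on (node e) {..k}"
      using gauss_lobatto_nodes_inj[OF rule] mesh_size_pos
      by (auto simp: inj_on_def cell_node_def)
    then have card: "card (node e ` {..k}) = k + 1" by (simp add: card_image)
    have "degree (\<Sum>i<dofs. p i) \<le> k"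
      by (intro degree_sum_le) (auto intro: p(1))
    then show "degree (\<Sum>i<dofs. p i) < card (node e ` {..k})" by (simp add: card)
    show "degree (1 :: real poly) < card (node e ` {..k})" by (simp add: card)
  qed
  then have "(\<Sum>i<dofs. pderiv (p i)) = 0"
    by (metis pderiv_1 pderiv_sum)
  then have "(\<Sum>i<dofs. poly (pderiv (p i)) (node e j)) = 0"
    by (metis poly_0 poly_sum)
  then show ?thesis by (simp add: deriv)
qed

text \<open>Off the diagonal every quadrature term vanishes because no node belongs to two basis functions.  The
  diagonal is positive because each basis function takes the value one at some quadrature node, whose
  weight is positive.\<close>

lemma mass_eq_diag:
  obtains \<mu> where "mass = mat_diag dofs \<mu>" "\<And>i. i < dofs \<Longrightarrow> \<mu> i > 0"
proof
  define \<mu> where "\<mu> i = quad1 k \<xi> \<omega> a b M (\<lambda>_. \<phi> i) (\<lambda>_. \<phi> i)" for i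
  show "mass = mat_diag dofs \<mu>"
    by (rule eq_matI)
      (auto simp: mass_matrix_def mat_diag_def \<mu>_def quad1_def basis_at_node intro!: sum.neutral)
  fix i assume i: "i < dofs"
  then obtain e j where ej: "e < M" "j \<le> k" "i = e * k + j" by (rule dof_is_node)
  have nonneg: "0 \<le> node_weight l * (\<phi> i (node e' l) * \<phi> i (node e' l))" if "l \<le> k" for e' l
    by (rule mult_nonneg_nonneg[OF less_imp_le[OF node_weight_pos[OF that]] zero_le_square])
  have pos: "0 < node_weight j * (\<phi> i (node e j) * \<phi> i (node e j))"
    using node_weight_pos[OF ej(2)] basis_at_node[OF i ej(1,2)] ej(3) by simp
  have inner: "0 < (\<Sum>l\<le>k. node_weight l * (\<phi> i (node e l) * \<phi> i (node e l)))"
    using ej(2) by (intro sum_pos2[where i = j] pos nonneg) auto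
  show "\<mu> i > 0"
    unfolding \<mu>_def quad1_def
  proof (rule sum_pos2[where i = e])
    show "0 \<le> (\<Sum>l\<le>k. node_weight l * (\<phi> i (node e' l) * \<phi> i (node e' l)))" for e'
      by (intro sum_nonneg nonneg) simp
  qed (use ej(1) inner in simp_all)
qed

lemma mass_inverse:
  obtains B where "mat_inverse mass = Some B" "B \<in> carrier_mat dofs dofs" "mass * B = 1\<^sub>m dofs"
proof -
  obtain \<mu> where \<mu>: "mass = mat_diag dofs \<mu>" "\<And>i. i < dofs \<Longrightarrow> \<mu> i > 0"
    using mass_eq_diag by blast
  have ne: "\<mu> i \<noteq> 0" if "i < dofs" for i
    using \<mu>(2)[OF that] by linarith
  define D where "D = mat_diag dofs (\<lambda>i. 1 / \<mu> i)"
  have "mat_diag dofs (\<lambda>i. \<mu> i * (1 / \<mu> i)) = 1\<^sub>m dofs"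
    by (rule eq_matI) (use ne in \<open>auto simp: mat_diag_def\<close>)
  moreover have "mat_diag dofs (\<lambda>i. 1 / \<mu> i * \<mu> i) = 1\<^sub>m dofs"
    by (rule eq_matI) (use ne in \<open>auto simp: mat_diag_def\<close>)
  ultimately have "mass * D = 1\<^sub>m dofs" "D * mass = 1\<^sub>m dofs"
    unfolding \<mu>(1) D_def by (simp_all only: mat_diag_diag)
  then have "mass \<in> Units (ring_mat TYPE(real) dofs ())"
    using mass_carrier unfolding Units_def ring_mat_def by (auto simp: D_def intro!: bexI[of _ D])
  then obtain B where "mat_inverse mass = Some B"
    using mat_inverse(1)[OF mass_carrier, where b = "()"] by blast
  then show ?thesis
    using that mat_inverse(2)[OF mass_carrier] by blast
qed

text \<open>Summing a row of a quadrature matrix: the sum over the basis functions moves inside the quadrature,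
  where it meets the partition of unity.\<close>

lemma sum_swap_nodes:
  "(\<Sum>l<n. \<Sum>e<M. \<Sum>j\<le>k. c j * (f e j * g l e j))
    = (\<Sum>e<M. \<Sum>j\<le>k. c j * f e j * (\<Sum>l<n. g l e j))"
  for c :: "nat \<Rightarrow> real"
proof -
  have "(\<Sum>l<n. \<Sum>e<M. \<Sum>j\<le>k. c j * (f e j * g l e j))
      = (\<Sum>e<M. \<Sum>j\<le>k. \<Sum>l<n. c j * (f e j * g l e j))"
    by (subst sum.swap, rule sum.cong[OF refl], rule sum.swap)
  then show ?thesis by (simp only: sum_distrib_left mult.assoc)
qed

text \<open>The total of a row of the mass matrix is the quadrature of a single basis function, by the partition
  of unity.\<close>

lemma mass_ones_index:
  assumes "i < dofs"
  shows "vec_index (mass *\<^sub>v ones_vec dofs) i = (\<Sum>e<M. \<Sum>j\<le>k. node_weight j * \<phi> i (node e j))"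
proof -
  have "vec_index (mass *\<^sub>v ones_vec dofs) i
      = (\<Sum>l<dofs. \<Sum>e<M. \<Sum>j\<le>k. node_weight j * (\<phi> i (node e j) * \<phi> l (node e j)))"
    using assms
    by (simp add: mass_matrix_def ones_vec_def scalar_prod_def quad1_def atLeast0LessThan)
  also have "\<dots> = (\<Sum>e<M. \<Sum>j\<le>k. node_weight j * \<phi> i (node e j) * (\<Sum>l<dofs. \<phi> l (node e j)))"
    by (rule sum_swap_nodes)
  also have "\<dots> = (\<Sum>e<M. \<Sum>j\<le>k. node_weight j * \<phi> i (node e j))"
    by (intro sum.cong refl) (simp only: partition_of_unity_at_node lessThan_iff atMost_iff mult_1_right)
  finally show ?thesis .
qed

text \<open>The quadrature of the constant one is exact, so it gives the length of the interval.\<close>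

lemma ones_mass_ones: "scalar_prod (ones_vec dofs) (mass *\<^sub>v ones_vec dofs) = b - a"
proof -
  have "scalar_prod (ones_vec dofs) (mass *\<^sub>v ones_vec dofs)
      = (\<Sum>i<dofs. vec_index (mass *\<^sub>v ones_vec dofs) i)"
    using mass_carrier by (simp add: scalar_prod_def ones_vec_def atLeast0LessThan)
  also have "\<dots> = (\<Sum>i<dofs. \<Sum>e<M. \<Sum>j\<le>k. node_weight j * \<phi> i (node e j))"
    by (intro sum.cong refl mass_ones_index) simp
  also have "\<dots> = (\<Sum>e<M. \<Sum>j\<le>k. node_weight j * (\<Sum>i<dofs. \<phi> i (node e j)))"
    using sum_swap_nodes[where n = dofs and c = node_weight and f = "\<lambda>_ _. 1"] by (simp only: mult_1_left mult_1_right)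
  also have "\<dots> = (\<Sum>e<M. \<Sum>j\<le>k. node_weight j)"
    by (intro sum.cong refl) (simp only: partition_of_unity_at_node lessThan_iff atMost_iff mult_1_right)
  also have "\<dots> = real M * (mesh_size a b M / 2 * (\<Sum>j\<le>k. \<omega> j))"
    by (simp add: sum_distrib_left)
  also have "\<dots> = b - a"
    using cells by (simp add: gauss_lobatto_weights_sum[OF rule degree_pos] mesh_size_def)
  finally show ?thesis .
qed

text \<open>Constants lie in the kernel of the stiffness matrix because the derivatives of the basis functions
  cancel at every quadrature node.  This is the discrete homogeneous Neumann condition.\<close>

lemma stiffness_ones: "stiffness *\<^sub>v ones_vec dofs = 0\<^sub>v dofs"
proof (rule eq_vecI)
  fix i assume "i < dim_vec (0\<^sub>v dofs)"
  then have i: "i < dofs" by simp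
  let ?d = "\<lambda>i e j. cell_deriv a b M (\<phi> i) e (node e j)"
  have "vec_index (stiffness *\<^sub>v ones_vec dofs) i
      = (\<Sum>l<dofs. \<Sum>e<M. \<Sum>j\<le>k. node_weight j * (?d i e j * ?d l e j))"
    using i by (simp add: stiffness_matrix_def ones_vec_def scalar_prod_def quad1_def atLeast0LessThan)
  also have "\<dots> = (\<Sum>e<M. \<Sum>j\<le>k. node_weight j * ?d i e j * (\<Sum>l<dofs. ?d l e j))"
    by (rule sum_swap_nodes)
  also have "\<dots> = 0"
    by (intro sum.neutral ballI) (simp only: sum_cell_deriv_basis lessThan_iff atMost_iff mult_zero_right)
  finally show "vec_index (stiffness *\<^sub>v ones_vec dofs) i = vec_index (0\<^sub>v dofs) i" using i by simp
qed (simp add: stiffness_matrix_def)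

lemma laplacian_carrier: "laplacian \<in> carrier_mat dofs dofs"
proof -
  obtain B where "mat_inverse mass = Some B" "B \<in> carrier_mat dofs dofs"
    using mass_inverse by blast
  then show ?thesis
    using stiffness_carrier by (simp add: discrete_laplacian_def)
qed

text \<open>The discrete counterpart of the vanishing integral of a Laplacian: the mass matrix cancels the inverse
  inside the discrete Laplacian, and what remains is the stiffness matrix applied to a constant.\<close>

lemma transpose_laplacian_mass_ones:
  "transpose_mat laplacian *\<^sub>v (mass *\<^sub>v ones_vec dofs) = 0\<^sub>v dofs"
proof -
  obtain B where B: "mat_inverse mass = Some B" "B \<in> carrier_mat dofs dofs" "mass * B = 1\<^sub>m dofs"
    by (rule mass_inverse)
  note carr = mass_carrier stiffness_carrier B(2) ones_vec_carrier
  have "transpose_mat B * mass = 1\<^sub>m dofs"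
    using transpose_mult[OF mass_carrier B(2)] B(3) by (simp add: transpose_mass)
  then have 1: "transpose_mat B *\<^sub>v (mass *\<^sub>v ones_vec dofs) = ones_vec dofs"
    using assoc_mult_mat_vec[of "transpose_mat B" dofs dofs mass dofs "ones_vec dofs"] carr
    by (simp only: transpose_carrier_mat one_mult_mat_vec)
  have "transpose_mat (B * stiffness) *\<^sub>v (mass *\<^sub>v ones_vec dofs)
      = stiffness *\<^sub>v (transpose_mat B *\<^sub>v (mass *\<^sub>v ones_vec dofs))"
    unfolding transpose_mult[OF B(2) stiffness_carrier] transpose_stiffness
    by (rule assoc_mult_mat_vec[where n\<^sub>2 = dofs and n\<^sub>3 = dofs]) (use carr in auto)
  also have "\<dots> = 0\<^sub>v dofs" unfolding 1 by (rule stiffness_ones)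
  finally have 2: "transpose_mat (B * stiffness) *\<^sub>v (mass *\<^sub>v ones_vec dofs) = 0\<^sub>v dofs" .
  have "laplacian = - (B * stiffness)" by (simp add: discrete_laplacian_def B(1))
  then show ?thesis
    using carr 2 by (simp add: transpose_uminus)
qed

end

section \<open>Bilinear forms and mass\<close>

text \<open>Outer factors of a matrix product act on the two test vectors of a bilinear form.  In this form each
  conservation law becomes a statement about two vectors, without reassociating matrix products.\<close>

lemma scalar_prod_mult_transpose:
  fixes A B W :: "real mat"
  assumes A: "A \<in> carrier_mat m p" and W: "W \<in> carrier_mat p q" and B: "B \<in> carrier_mat n q"
    and u: "u \<in> carrier_vec m" and v: "v \<in> carrier_vec n"
  shows "scalar_prod u ((A * W * transpose_mat B) *\<^sub>v v)
    = scalar_prod (transpose_mat A *\<^sub>v u) (W *\<^sub>v (transpose_mat B *\<^sub>v v))"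
proof -
  have "(A * W * transpose_mat B) *\<^sub>v v = A *\<^sub>v (W *\<^sub>v (transpose_mat B *\<^sub>v v))"
    using A W B v by (subst assoc_mult_mat_vec[of _ m q _ n]) (auto intro!: assoc_mult_mat_vec)
  then show ?thesis
    using A W B u v by (subst transpose_vec_mult_scalar[of A m p]) auto
qed

lemma scalar_prod_add_mult_mat_vec:
  fixes A B :: "real mat"
  assumes "A \<in> carrier_mat m n" "B \<in> carrier_mat m n" "x \<in> carrier_vec m" "y \<in> carrier_vec n"
  shows "scalar_prod x ((A + B) *\<^sub>v y) = scalar_prod x (A *\<^sub>v y) + scalar_prod x (B *\<^sub>v y)"
  using assms by (simp add: add_mult_distrib_mat_vec[of _ m n] scalar_prod_add_distrib[of _ m])

lemma scalar_prod_smult_mult_mat_vec: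
  fixes A :: "real mat"
  assumes "A \<in> carrier_mat m n" "x \<in> carrier_vec m" "y \<in> carrier_vec n"
  shows "scalar_prod x ((c \<cdot>\<^sub>m A) *\<^sub>v y) = c * scalar_prod x (A *\<^sub>v y)"
proof -
  have "(c \<cdot>\<^sub>m A) *\<^sub>v y = c \<cdot>\<^sub>v (A *\<^sub>v y)"
    by (rule eq_vecI) (use assms in auto)
  then show ?thesis using assms by simp
qed

text \<open>The discrete mass is a bilinear form in the two vectors of nodal quadrature weights; it is linear in
  \<open>W\<close>, and the outer factors of a low-rank \<open>W\<close> can be moved onto these vectors.\<close>

lemma mass_inner_ones:
  assumes Mx: "Mx \<in> carrier_mat m m" and My: "My \<in> carrier_mat n n"
    and sym: "transpose_mat Mx = Mx" and W: "W \<in> carrier_mat m n"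
  shows "mass_inner Mx My W (ones_mat m n)
    = scalar_prod (Mx *\<^sub>v ones_vec m) (W *\<^sub>v (My *\<^sub>v ones_vec n))"
proof -
  let ?X = "Mx * W * My"
  have X: "?X \<in> carrier_mat m n" using Mx My W by simp
  have q: "ones_vec m \<in> carrier_vec m" "ones_vec n \<in> carrier_vec n" by (auto simp: ones_vec_def)
  have trace_sum: "(\<Sum>j<n. (transpose_mat X * ones_mat m n) $$ (j, j))
      = scalar_prod (ones_vec m) (X *\<^sub>v ones_vec n)" if X: "X \<in> carrier_mat m n" for X :: "real mat"
  proof -
    have "(\<Sum>j<n. (transpose_mat X * ones_mat m n) $$ (j, j)) = (\<Sum>j<n. \<Sum>i<m. X $$ (i, j))"
      using X by (auto simp: ones_mat_def scalar_prod_def atLeast0LessThan intro!: sum.cong)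
    also have "\<dots> = (\<Sum>i<m. \<Sum>j<n. X $$ (i, j))" by (rule sum.swap)
    also have "\<dots> = scalar_prod (ones_vec m) (X *\<^sub>v ones_vec n)"
      using X by (auto simp: ones_vec_def scalar_prod_def atLeast0LessThan intro!: sum.cong)
    finally show ?thesis .
  qed
  have "mass_inner Mx My W (ones_mat m n) = scalar_prod (ones_vec m) (?X *\<^sub>v ones_vec n)"
    using trace_sum[OF X] by (simp add: mass_inner_def frob_inner_def ones_mat_def)
  also have "?X *\<^sub>v ones_vec n = Mx *\<^sub>v (W *\<^sub>v (My *\<^sub>v ones_vec n))"
    using Mx My W q by (subst assoc_mult_mat_vec[of _ m n _ n]) (auto intro!: assoc_mult_mat_vec)
  also have "scalar_prod (ones_vec m) \<dots>
      = scalar_prod (Mx *\<^sub>v ones_vec m) (W *\<^sub>v (My *\<^sub>v ones_vec n))"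
    using transpose_vec_mult_scalar[OF Mx _ q(1), of "W *\<^sub>v (My *\<^sub>v ones_vec n)"] sym My W q
    by simp
  finally show ?thesis .
qed

section \<open>The matrix exponential\<close>

text \<open>The matrix exponential is given by series of entries; this bound compares them with the scalar
  exponential series of \<open>n * c\<close>.\<close>

lemma pow_mat_entry_bound:
  fixes A :: "real mat"
  assumes A: "A \<in> carrier_mat n n" and c: "\<And>i j. i < n \<Longrightarrow> j < n \<Longrightarrow> \<bar>A $$ (i, j)\<bar> \<le> c"
    and "i < n" "j < n"
  shows "\<bar>(A ^\<^sub>m l) $$ (i, j)\<bar> \<le> (real n * c) ^ l"
  using assms(3,4)
proof (induction l arbitrary: j)
  case 0
  then show ?case using A by simp
next
  case (Suc l)
  have c0: "0 \<le> c" using c[OF Suc.prems] by (meson abs_ge_zero order.trans)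
  have P: "A ^\<^sub>m l \<in> carrier_mat n n" using A by (rule pow_carrier_mat)
  have "(A ^\<^sub>m Suc l) $$ (i, j) = (\<Sum>s<n. (A ^\<^sub>m l) $$ (i, s) * A $$ (s, j))"
    using A P Suc.prems by (auto simp: scalar_prod_def atLeast0LessThan intro!: sum.cong)
  also have "\<bar>\<dots>\<bar> \<le> (\<Sum>s<n. (real n * c) ^ l * c)"
    using Suc.IH[OF Suc.prems(1)] c Suc.prems c0
    by (intro order.trans[OF sum_abs] sum_mono) (auto simp: abs_mult intro!: mult_mono)
  also have "\<dots> = (real n * c) ^ Suc l" by simp
  finally show ?case .
qed

lemma summable_mat_exp_entry:
  fixes A :: "real mat"
  assumes A: "A \<in> carrier_mat n n" and ij: "i < n" "j < n"
  shows "summable (\<lambda>l. (A ^\<^sub>m l) $$ (i, j) / fact l)"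
proof (rule summable_comparison_test')
  define c where "c = (\<Sum>i<n. \<Sum>j<n. \<bar>A $$ (i, j)\<bar>)"
  have c: "\<bar>A $$ (i, j)\<bar> \<le> c" if "i < n" "j < n" for i j
  proof -
    have "\<bar>A $$ (i, j)\<bar> \<le> (\<Sum>j<n. \<bar>A $$ (i, j)\<bar>)"
      using that by (intro member_le_sum) auto
    also have "\<dots> \<le> c" unfolding c_def
      using that by (intro member_le_sum[where f = "\<lambda>i. \<Sum>j<n. \<bar>A $$ (i, j)\<bar>"] sum_nonneg) auto
    finally show ?thesis .
  qed
  show "summable (\<lambda>l. inverse (fact l) * (real n * c) ^ l)" by (rule summable_exp)
  show "norm ((A ^\<^sub>m l) $$ (i, j) / fact l) \<le> inverse (fact l) * (real n * c) ^ l" for l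
    using pow_mat_entry_bound[OF A c ij, of l] by (simp add: divide_simps)
qed

text \<open>On a vector in the kernel every positive power vanishes, so only the zeroth term of the exponential
  series survives.\<close>

lemma transpose_mat_exp_fixes:
  assumes A: "A \<in> carrier_mat n n" and u: "u \<in> carrier_vec n"
    and ker: "transpose_mat A *\<^sub>v u = 0\<^sub>v n"
  shows "transpose_mat (mat_exp A) *\<^sub>v u = u"
proof (rule eq_vecI)
  fix j assume "j < dim_vec u"
  then have j: "j < n" using u by simp
  have P: "A ^\<^sub>m l \<in> carrier_mat n n" for l using A by (rule pow_carrier_mat)
  have row_sum: "(\<Sum>i<n. (A ^\<^sub>m l) $$ (i, j) * vec_index u i) = vec_index (transpose_mat (A ^\<^sub>m l) *\<^sub>v u) j" for l
    using carrier_matD[OF P[of l]] u j by (auto simp: scalar_prod_def atLeast0LessThan intro!: sum.cong)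
  have pow: "transpose_mat (A ^\<^sub>m l) *\<^sub>v u = (if l = 0 then u else 0\<^sub>v n)" for l
  proof (induction l)
    case (Suc l)
    have "transpose_mat (A ^\<^sub>m Suc l) *\<^sub>v u = transpose_mat A *\<^sub>v (transpose_mat (A ^\<^sub>m l) *\<^sub>v u)"
      using A P[of l] u by (simp add: transpose_mult[of _ n n _ n] assoc_mult_mat_vec[of _ n n _ n])
    then show ?case
      using A by (auto simp: Suc.IH ker)
  qed (use A u in simp)
  have "vec_index (transpose_mat (mat_exp A) *\<^sub>v u) j
      = (\<Sum>i<n. (\<Sum>l. (A ^\<^sub>m l) $$ (i, j) / fact l) * vec_index u i)"
    using A u j by (auto simp: mat_exp_def scalar_prod_def atLeast0LessThan intro!: sum.cong)
  also have "\<dots> = (\<Sum>i<n. \<Sum>l. (A ^\<^sub>m l) $$ (i, j) / fact l * vec_index u i)"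
    using j by (intro sum.cong refl suminf_mult2 summable_mat_exp_entry[OF A]) auto
  also have "\<dots> = (\<Sum>l. \<Sum>i<n. (A ^\<^sub>m l) $$ (i, j) / fact l * vec_index u i)"
    using j by (intro suminf_sum[symmetric] summable_mult2 summable_mat_exp_entry[OF A]) auto
  also have "\<dots> = (\<Sum>l. (\<Sum>i<n. (A ^\<^sub>m l) $$ (i, j) * vec_index u i) / fact l)"
    by (simp add: sum_divide_distrib)
  also have "\<dots> = (\<Sum>l. if l = 0 then vec_index u j else 0)"
    unfolding row_sum pow using j by (intro suminf_cong) auto
  also have "\<dots> = vec_index u j"
    by (subst suminf_finite[of "{0}"]) auto
  finally show "vec_index (transpose_mat (mat_exp A) *\<^sub>v u) j = vec_index u j" .
qed (use A u in \<open>simp add: mat_exp_def\<close>)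

lemma transpose_mat_exp_smult_fixes:
  assumes A: "A \<in> carrier_mat n n" and u: "u \<in> carrier_vec n"
    and ker: "transpose_mat A *\<^sub>v u = 0\<^sub>v n"
  shows "transpose_mat (mat_exp (t \<cdot>\<^sub>m A)) *\<^sub>v u = u"
proof (rule transpose_mat_exp_fixes)
  have "transpose_mat (t \<cdot>\<^sub>m A) = t \<cdot>\<^sub>m transpose_mat A" by (rule eq_matI) auto
  moreover have "(t \<cdot>\<^sub>m transpose_mat A) *\<^sub>v u = t \<cdot>\<^sub>v (transpose_mat A *\<^sub>v u)"
    by (rule eq_vecI) (use A u in auto)
  ultimately show "transpose_mat (t \<cdot>\<^sub>m A) *\<^sub>v u = 0\<^sub>v n" by (auto simp: ker)
qed (use A u in auto)

section \<open>Truncated singular value decompositions\<close>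

lemma orthogonal_preserves_norm:
  fixes R :: "real mat"
  assumes R: "R \<in> carrier_mat p p" and orth: "transpose_mat R * R = 1\<^sub>m p" and x: "x \<in> carrier_vec p"
  shows "scalar_prod (transpose_mat R *\<^sub>v x) (transpose_mat R *\<^sub>v x) = scalar_prod x x"
proof -
  have "R * transpose_mat R = 1\<^sub>m p"
    using mat_mult_left_right_inverse[of "transpose_mat R" p R] R orth by simp
  moreover have "scalar_prod (transpose_mat R *\<^sub>v x) (transpose_mat R *\<^sub>v x)
      = scalar_prod x (R *\<^sub>v (transpose_mat R *\<^sub>v x))"
    using R x by (intro transpose_vec_mult_scalar) auto
  moreover have "R *\<^sub>v (transpose_mat R *\<^sub>v x) = (R * transpose_mat R) *\<^sub>v x"
    using R x by (simp add: assoc_mult_mat_vec[of _ p p _ p])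
  ultimately show ?thesis using x by simp
qed

lemma first_cols_carrier: "s \<le> dim_col R \<Longrightarrow> first_cols s R \<in> carrier_mat (dim_row R) s"
  unfolding first_cols_def carrier_mat_def by simp

lemma transpose_first_cols_mult_index:
  fixes R :: "real mat"
  assumes "R \<in> carrier_mat p q" "s \<le> q" "i < s" "x \<in> carrier_vec p"
  shows "vec_index (transpose_mat (first_cols s R) *\<^sub>v x) i = vec_index (transpose_mat R *\<^sub>v x) i"
proof -
  have "col (first_cols s R) i = col R i"
    using assms unfolding first_cols_def by (subst col_mat_of_cols) auto
  then show ?thesis using assms by (auto simp: first_cols_def)
qed

text \<open>In the singular bases the difference is the sum of \<open>\<sigma> i * \<xi> i * \<zeta> i\<close> over the discarded indices, with
  rotated test vectors \<open>\<xi>\<close> and \<open>\<zeta>\<close>.  Bounding \<open>\<zeta> i\<close> by the norm of \<open>\<zeta>\<close> and applying the Cauchy--Schwarz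
  inequality to the rest gives the estimate, since orthogonal matrices preserve norms.\<close>

lemma truncation_form_error:
  assumes svd: "is_svd A R \<sigma> P" and A: "A \<in> carrier_mat p q" and s: "s \<le> min p q"
    and x: "x \<in> carrier_vec p" and y: "y \<in> carrier_vec q"
  shows "\<bar>scalar_prod x ((first_cols s R * mat_diag s \<sigma> * transpose_mat (first_cols s P)) *\<^sub>v y)
      - scalar_prod x (A *\<^sub>v y)\<bar>
    \<le> sqrt (\<Sum>i = s..<min p q. (\<sigma> i)\<^sup>2) * (sqrt (scalar_prod x x) * sqrt (scalar_prod y y))"
proof -
  have R: "R \<in> carrier_mat p p" "transpose_mat R * R = 1\<^sub>m p"
    and P: "P \<in> carrier_mat q q" "transpose_mat P * P = 1\<^sub>m q"
    and A_eq: "A = R * Matrix.mat p q (\<lambda>(i, j). if i = j then \<sigma> i else 0) * transpose_mat P"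
    using svd A unfolding is_svd_def Let_def by auto
  define \<xi> where "\<xi> = transpose_mat R *\<^sub>v x"
  define \<zeta> where "\<zeta> = transpose_mat P *\<^sub>v y"
  have \<xi>: "\<xi> \<in> carrier_vec p" and \<zeta>: "\<zeta> \<in> carrier_vec q"
    using R P x y by (auto simp: \<xi>_def \<zeta>_def)
  have Ds: "mat_diag s \<sigma> \<in> carrier_mat s s" by simp
  have Rs: "first_cols s R \<in> carrier_mat p s" and Ps: "first_cols s P \<in> carrier_mat q s"
    using first_cols_carrier[of s R] first_cols_carrier[of s P] R P s by auto
  have full: "scalar_prod x (A *\<^sub>v y) = (\<Sum>i<min p q. \<sigma> i * vec_index \<xi> i * vec_index \<zeta> i)"
  proof -
    have "scalar_prod x (A *\<^sub>v y)
        = scalar_prod \<xi> (Matrix.mat p q (\<lambda>(i, j). if i = j then \<sigma> i else 0) *\<^sub>v \<zeta>)"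
      unfolding A_eq \<xi>_def \<zeta>_def by (rule scalar_prod_mult_transpose) (use R P x y in auto)
    also have "\<dots> = (\<Sum>i<p. vec_index \<xi> i * (\<Sum>j<q. (if i = j then \<sigma> i else 0) * vec_index \<zeta> j))"
      using \<zeta> by (auto simp: scalar_prod_def atLeast0LessThan intro!: sum.cong)
    also have "\<dots> = (\<Sum>i<p. if i < q then \<sigma> i * vec_index \<xi> i * vec_index \<zeta> i else 0)"
      by (auto simp: if_distrib[where f = "\<lambda>z. z * _"] cong: if_cong intro!: sum.cong)
    also have "\<dots> = (\<Sum>i<min p q. \<sigma> i * vec_index \<xi> i * vec_index \<zeta> i)"
      by (subst sum.inter_filter[symmetric]) (auto intro!: sum.cong)
    finally show ?thesis .
  qed
  have head: "scalar_prod x ((first_cols s R * mat_diag s \<sigma> * transpose_mat (first_cols s P)) *\<^sub>v y)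
      = (\<Sum>i<s. \<sigma> i * vec_index \<xi> i * vec_index \<zeta> i)"
  proof -
    have diag_form: "scalar_prod w (mat_diag s \<sigma> *\<^sub>v z) = (\<Sum>i<s. vec_index w i * (\<sigma> i * vec_index z i))"
      if "w \<in> carrier_vec s" "z \<in> carrier_vec s" for w z
      using that by (auto simp: mat_diag_def scalar_prod_def atLeast0LessThan
          if_distrib[where f = "\<lambda>z. z * _"] cong: if_cong intro!: sum.cong)
    have "scalar_prod x ((first_cols s R * mat_diag s \<sigma> * transpose_mat (first_cols s P)) *\<^sub>v y)
        = scalar_prod (transpose_mat (first_cols s R) *\<^sub>v x)
            (mat_diag s \<sigma> *\<^sub>v (transpose_mat (first_cols s P) *\<^sub>v y))"
      by (rule scalar_prod_mult_transpose[OF Rs Ds Ps x y])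
    also have "\<dots> = (\<Sum>i<s. vec_index (transpose_mat (first_cols s R) *\<^sub>v x) i
            * (\<sigma> i * vec_index (transpose_mat (first_cols s P) *\<^sub>v y) i))"
      using Rs Ps x y by (intro diag_form) auto
    also have "\<dots> = (\<Sum>i<s. \<sigma> i * vec_index \<xi> i * vec_index \<zeta> i)"
      using transpose_first_cols_mult_index[OF R(1) _ _ x] transpose_first_cols_mult_index[OF P(1) _ _ y] s
      by (auto simp: \<xi>_def \<zeta>_def simp del: index_mult_mat_vec intro!: sum.cong)
    finally show ?thesis .
  qed
  let ?T = "{s..<min p q}"
  have subset: "?T \<subseteq> {..<p}" by auto
  have split: "(\<Sum>i<min p q. f i) = (\<Sum>i<s. f i) + (\<Sum>i\<in>?T. f i)" for f :: "nat \<Rightarrow> real"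
    using s by (metis lessThan_atLeast0 sum.atLeastLessThan_concat zero_le)
  have norms: "scalar_prod \<xi> \<xi> = scalar_prod x x" "scalar_prod \<zeta> \<zeta> = scalar_prod y y"
    unfolding \<xi>_def \<zeta>_def by (rule orthogonal_preserves_norm[OF R x] orthogonal_preserves_norm[OF P y])+
  have sq_sum: "(\<Sum>i\<in>I. (vec_index z i)\<^sup>2) \<le> scalar_prod z z" if "I \<subseteq> {..<dim_vec z}" for z :: "real Matrix.vec" and I
    using that by (auto simp: scalar_prod_def atLeast0LessThan power2_eq_square intro!: sum_mono2)
  have \<zeta>_bound: "\<bar>vec_index \<zeta> i\<bar> \<le> sqrt (scalar_prod y y)" if "i \<in> ?T" for i
    using sq_sum[of "{i}" \<zeta>] \<zeta> that norms(2) by (auto intro!: real_le_rsqrt simp: power2_abs)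
  have "\<bar>\<Sum>i\<in>?T. \<sigma> i * vec_index \<xi> i * vec_index \<zeta> i\<bar>
      \<le> (\<Sum>i\<in>?T. \<bar>\<sigma> i\<bar> * \<bar>vec_index \<xi> i\<bar> * sqrt (scalar_prod y y))"
    by (intro order.trans[OF sum_abs] sum_mono) (auto simp: abs_mult intro!: mult_left_mono \<zeta>_bound)
  also have "\<dots> = (\<Sum>i\<in>?T. \<bar>\<sigma> i\<bar> * \<bar>vec_index \<xi> i\<bar>) * sqrt (scalar_prod y y)"
    by (simp add: sum_distrib_right)
  also have "\<dots> \<le> (L2_set \<sigma> ?T * L2_set (vec_index \<xi>) ?T) * sqrt (scalar_prod y y)"
    using norms(2) sq_sum[of "{}" y] by (intro mult_right_mono L2_set_mult_ineq) auto
  also have "\<dots> \<le> (L2_set \<sigma> ?T * sqrt (scalar_prod x x)) * sqrt (scalar_prod y y)"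
    using sq_sum[of ?T \<xi>] \<xi> norms(1) sq_sum[of "{}" y] subset unfolding L2_set_def
    by (intro mult_right_mono mult_left_mono) (auto intro: sum_nonneg)
  finally have "\<bar>\<Sum>i\<in>?T. \<sigma> i * vec_index \<xi> i * vec_index \<zeta> i\<bar>
      \<le> L2_set \<sigma> ?T * (sqrt (scalar_prod x x) * sqrt (scalar_prod y y))" by (simp add: mult.assoc)
  then show ?thesis
    unfolding head full split L2_set_def by simp
qed

section \<open>Conservation of mass in the steps of the scheme\<close>

lemma transpose_mult_mat_vec:
  fixes A B :: "real mat"
  assumes "A \<in> carrier_mat m p" "B \<in> carrier_mat p q" "u \<in> carrier_vec m"
  shows "transpose_mat (A * B) *\<^sub>v u = transpose_mat B *\<^sub>v (transpose_mat A *\<^sub>v u)"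
  using assms by (simp add: transpose_mult assoc_mult_mat_vec[of _ q p _ m])

lemma gqr_carriers:
  assumes "gqr A Mm Q R" "A \<in> carrier_mat m c"
  obtains s where "Q \<in> carrier_mat m s" "R \<in> carrier_mat s c" "A = Q * R"
    "transpose_mat Q * Mm * Q = 1\<^sub>m s"
  using assms unfolding gqr_def by auto

text \<open>Since \<open>Q\<close> is orthonormal for \<open>Mm\<close>, the map \<open>x \<mapsto> Q * Q\<^sup>T * Mm * x\<close> is a projection onto
  the column space of \<open>Q\<close>, which contains the columns of \<open>A\<close>.\<close>

lemma gqr_projection_col:
  assumes gqr: "gqr A Mm Q R" and A: "A \<in> carrier_mat m c" and Mm: "Mm \<in> carrier_mat m m"
    and j: "j < c"
  shows "Q *\<^sub>v (transpose_mat Q *\<^sub>v (Mm *\<^sub>v col A j)) = col A j"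
proof -
  obtain s where Q: "Q \<in> carrier_mat m s" and R: "R \<in> carrier_mat s c" and AQR: "A = Q * R"
    and orth: "transpose_mat Q * Mm * Q = 1\<^sub>m s"
    using gqr A by (rule gqr_carriers)
  define y where "y = col R j"
  have y: "y \<in> carrier_vec s" using R j by (auto simp: y_def)
  have col: "col A j = Q *\<^sub>v y"
    unfolding AQR y_def using Q R j by (rule col_mult2)
  have "transpose_mat Q *\<^sub>v (Mm *\<^sub>v (Q *\<^sub>v y)) = (transpose_mat Q * Mm * Q) *\<^sub>v y"
    using Q Mm y by (simp add: assoc_mult_mat_vec[of _ s m _ s] assoc_mult_mat_vec[of _ s m _ m])
  then show ?thesis
    unfolding col orth using y by simp
qed

text \<open>The algebraic structure behind conservation: symmetric mass matrices, and Laplacians that have the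
  vector of quadrature weights as a left null vector.  Positivity of the two total masses makes the
  division by the area in RSLM legitimate.\<close>

locale conservative_scheme =
  fixes m n :: nat and Mx My Lx Ly :: "real mat"
  assumes carriers: "Mx \<in> carrier_mat m m" "My \<in> carrier_mat n n"
      "Lx \<in> carrier_mat m m" "Ly \<in> carrier_mat n n"
    and symmetric: "transpose_mat Mx = Mx" "transpose_mat My = My"
    and laplacian_kernel: "transpose_mat Lx *\<^sub>v (Mx *\<^sub>v ones_vec m) = 0\<^sub>v m"
      "transpose_mat Ly *\<^sub>v (My *\<^sub>v ones_vec n) = 0\<^sub>v n"
    and total_mass_pos: "scalar_prod (ones_vec m) (Mx *\<^sub>v ones_vec m) > 0"
      "scalar_prod (ones_vec n) (My *\<^sub>v ones_vec n) > 0"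
begin

text \<open>\<open>u\<close> and \<open>v\<close> are the vectors of nodal quadrature weights, and \<open>total\<close> is the discrete mass.  On a
  Gauss--Lobatto mesh \<open>area\<close> is the true area of the rectangle, because the rule integrates constants
  exactly.\<close>

definition u where "u = Mx *\<^sub>v ones_vec m"
definition v where "v = My *\<^sub>v ones_vec n"
definition total where "total W = scalar_prod u (W *\<^sub>v v)"
definition area where "area = scalar_prod (ones_vec m) u * scalar_prod (ones_vec n) v"

lemma uv_carriers: "u \<in> carrier_vec m" "v \<in> carrier_vec n"
  using carriers ones_vec_carrier by (auto simp: u_def v_def)

lemma area_pos: "area > 0"
  using total_mass_pos by (simp add: area_def u_def v_def)

lemma mass_inner_eq_total:
  "W \<in> carrier_mat m n \<Longrightarrow> mass_inner Mx My W (ones_mat m n) = total W"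
  unfolding total_def u_def v_def by (rule mass_inner_ones[OF carriers(1,2) symmetric(1)])

lemma total_diff:
  "A \<in> carrier_mat m n \<Longrightarrow> B \<in> carrier_mat m n \<Longrightarrow> total (A - B) = total A - total B"
  using uv_carriers unfolding total_def
  by (simp add: minus_mult_distrib_mat_vec[of _ m n] scalar_prod_minus_distrib[of _ m])

lemma total_smult: "A \<in> carrier_mat m n \<Longrightarrow> total (c \<cdot>\<^sub>m A) = c * total A"
  unfolding total_def using uv_carriers by (intro scalar_prod_smult_mult_mat_vec)

lemma total_ones: "total (ones_mat m n) = area"
proof -
  have "ones_mat m n *\<^sub>v v = scalar_prod (ones_vec n) v \<cdot>\<^sub>v ones_vec m"
    using uv_carriers
    by (intro eq_vecI) (auto simp: ones_mat_def ones_vec_def scalar_prod_def)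
  then show ?thesis
    using uv_carriers ones_vec_carrier[of m] comm_scalar_prod[of u m "ones_vec m"]
    unfolding total_def area_def by simp
qed

lemma total_factored:
  assumes "U \<in> carrier_mat m p" "S \<in> carrier_mat p q" "V \<in> carrier_mat n q"
  shows "total (U * S * transpose_mat V)
    = scalar_prod (transpose_mat U *\<^sub>v u) (S *\<^sub>v (transpose_mat V *\<^sub>v v))"
  unfolding total_def using assms uv_carriers by (intro scalar_prod_mult_transpose)

lemma nonlin_carrier: "W \<in> carrier_mat m n \<Longrightarrow> nonlin nl area Mx My W \<in> carrier_mat m n"
  by (cases nl) (auto simp: Let_def ones_mat_def entry_pow_def)

text \<open>For RSLM the subtracted constant has the mass of \<open>W - entry_pow W 3\<close> because \<open>area\<close> is the discrete mass of the
  all-ones matrix; for BBLM the quotient of the two masses is chosen so that the masses cancel.\<close>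

lemma total_nonlin:
  assumes W: "W \<in> carrier_mat m n" and def: "nonlin_defined nl Mx My W"
  shows "total (nonlin nl area Mx My W) = 0"
proof -
  define F where "F = W - entry_pow W 3"
  define G where "G = ones_mat m n - entry_pow W 2"
  have FG: "F \<in> carrier_mat m n" "G \<in> carrier_mat m n" "ones_mat m n \<in> carrier_mat m n"
    using W by (auto simp: F_def G_def entry_pow_def ones_mat_def)
  have dims: "dim_row W = m" "dim_col W = n" using W by auto
  show ?thesis
  proof (cases nl)
    case RSLM
    have "nonlin nl area Mx My W = F - (1 / area * total F) \<cdot>\<^sub>m ones_mat m n"
      using RSLM mass_inner_eq_total[OF FG(1)] by (simp add: Let_def F_def dims)
    then show ?thesis
      using FG area_pos by (simp add: total_diff total_smult total_ones)
  next
    case BBLM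
    have "nonlin nl area Mx My W = F - (total F / total G) \<cdot>\<^sub>m G"
      using BBLM mass_inner_eq_total[OF FG(1)] mass_inner_eq_total[OF FG(2)]
      by (simp add: Let_def F_def G_def dims)
    moreover have "total G \<noteq> 0"
      using def BBLM mass_inner_eq_total[OF FG(2)] by (simp add: Let_def G_def dims)
    ultimately show ?thesis
      using FG by (simp add: total_diff total_smult)
  qed
qed

text \<open>The QR factors only rewrite the product \<open>E * W * F\<^sup>T\<close> of \<open>W\<close> with the two matrix exponentials, whose
  transposes fix the weight vectors.\<close>

lemma linear_step_total:
  assumes U: "U \<in> carrier_mat m p" and S: "S \<in> carrier_mat p q" and V: "V \<in> carrier_mat n q"
    and step: "linear_step t Mx My Lx Ly U S V U' S' V'"
  obtains p' q' where "U' \<in> carrier_mat m p'" "S' \<in> carrier_mat p' q'" "V' \<in> carrier_mat n q'"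
    "total (U' * S' * transpose_mat V') = total (U * S * transpose_mat V)"
proof -
  define E where "E = mat_exp (t \<cdot>\<^sub>m Lx)"
  define F where "F = mat_exp (t \<cdot>\<^sub>m Ly)"
  have EF: "E \<in> carrier_mat m m" "F \<in> carrier_mat n n"
    using carriers by (auto simp: E_def F_def mat_exp_def)
  have E_fix: "transpose_mat E *\<^sub>v u = u" and F_fix: "transpose_mat F *\<^sub>v v = v"
    unfolding E_def F_def using laplacian_kernel carriers uv_carriers
    by (auto intro!: transpose_mat_exp_smult_fixes simp flip: u_def v_def)
  obtain R P where gqr: "gqr (E * U) Mx U' R" "gqr (F * V) My V' P"
    and S': "S' = R * S * transpose_mat P"
    using step unfolding linear_step_def E_def F_def by blast
  obtain p' where U': "U' \<in> carrier_mat m p'" "R \<in> carrier_mat p' p" "E * U = U' * R"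
    using gqr_carriers[OF gqr(1)] EF U by (metis mult_carrier_mat)
  obtain q' where V': "V' \<in> carrier_mat n q'" "P \<in> carrier_mat q' q" "F * V = V' * P"
    using gqr_carriers[OF gqr(2)] EF V by (metis mult_carrier_mat)
  have S'c: "S' \<in> carrier_mat p' q'" using U' V' S S' by auto
  have RU: "transpose_mat R *\<^sub>v (transpose_mat U' *\<^sub>v u) = transpose_mat U *\<^sub>v u"
    using transpose_mult_mat_vec[OF U'(1,2) uv_carriers(1)]
      transpose_mult_mat_vec[OF EF(1) U uv_carriers(1)] by (simp add: U'(3) E_fix)
  have PV: "transpose_mat P *\<^sub>v (transpose_mat V' *\<^sub>v v) = transpose_mat V *\<^sub>v v"
    using transpose_mult_mat_vec[OF V'(1,2) uv_carriers(2)]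
      transpose_mult_mat_vec[OF EF(2) V uv_carriers(2)] by (simp add: V'(3) F_fix)
  have "total (U' * S' * transpose_mat V')
      = scalar_prod (transpose_mat U' *\<^sub>v u) (S' *\<^sub>v (transpose_mat V' *\<^sub>v v))"
    by (rule total_factored[OF U'(1) S'c V'(1)])
  also have "\<dots> = scalar_prod (transpose_mat R *\<^sub>v (transpose_mat U' *\<^sub>v u))
      (S *\<^sub>v (transpose_mat P *\<^sub>v (transpose_mat V' *\<^sub>v v)))"
    unfolding S' using U' V' S uv_carriers by (intro scalar_prod_mult_transpose) auto
  also have "\<dots> = total (U * S * transpose_mat V)"
    unfolding RU PV by (rule total_factored[OF U S V, symmetric])
  finally show ?thesis using that U'(1) S'c V'(1) by blast
qed

text \<open>The augmented bases contain the vectors of ones, so the Galerkin projections fix them.  Testing with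
  constants therefore cannot distinguish a projected matrix from the matrix itself: the projected
  initial value keeps its mass, and the projected nonlinearity keeps mass zero.\<close>

lemma galerkin_step_total:
  assumes U1: "U1 \<in> carrier_mat m p" and S1: "S1 \<in> carrier_mat p q" and V1: "V1 \<in> carrier_mat n q"
    and step: "galerkin_step nl area \<tau> Mx My U1 S1 V1 U2 S2 V2 Ub Sb Vb"
  obtains s s' where "Ub \<in> carrier_mat m s" "Sb \<in> carrier_mat s s'" "Vb \<in> carrier_mat n s'"
    "Ub *\<^sub>v (transpose_mat Ub *\<^sub>v u) = ones_vec m" "Vb *\<^sub>v (transpose_mat Vb *\<^sub>v v) = ones_vec n"
    "total (Ub * Sb * transpose_mat Vb) = total (U1 * S1 * transpose_mat V1)"
proof -
  define N where "N = nonlin nl area Mx My"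
  define Sb1 where "Sb1 = (transpose_mat Ub * Mx * U1) * S1 * transpose_mat (transpose_mat Vb * My * V1)"
  define Wb1 where "Wb1 = Ub * Sb1 * transpose_mat Vb"
  define Sb2 where "Sb2 = Sb1 + \<tau> \<cdot>\<^sub>m (transpose_mat Ub * Mx * N Wb1 * My * Vb)"
  define Wb2 where "Wb2 = Ub * Sb2 * transpose_mat Vb"
  obtain As R Bs P where
    gqrU: "gqr (hcat m (mat_of_cols m [ones_vec m] # As)) Mx Ub R" and
    gqrV: "gqr (hcat n (mat_of_cols n [ones_vec n] # Bs)) My Vb P" and
    def1: "nonlin_defined nl Mx My Wb1" and def2: "nonlin_defined nl Mx My Wb2" and
    Sb: "Sb = (1/2) \<cdot>\<^sub>m Sb1 + (1/2) \<cdot>\<^sub>m Sb2 + (\<tau>/2) \<cdot>\<^sub>m (transpose_mat Ub * Mx * N Wb2 * My * Vb)"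
    using step U1 V1 unfolding galerkin_step_def Let_def N_def Sb1_def Wb1_def Sb2_def Wb2_def
    by (simp only: carrier_matD) blast
  \<comment> \<open>The vector of ones is the first column of the matrix that is factorized.\<close>
  have range: "Q *\<^sub>v (transpose_mat Q *\<^sub>v (Mm *\<^sub>v ones_vec l)) = ones_vec l" "\<exists>s. Q \<in> carrier_mat l s"
    if gqr: "gqr (hcat l (mat_of_cols l [ones_vec l] # As)) Mm Q R" and Mm: "Mm \<in> carrier_mat l l"
    for l As Mm Q R
  proof -
    let ?A = "hcat l (mat_of_cols l [ones_vec l] # As)"
    have cols: "cols (mat_of_cols l [ones_vec l]) = [ones_vec l]"
      using ones_vec_carrier by (intro cols_mat_of_cols) auto
    have A: "?A \<in> carrier_mat l (dim_col ?A)" and pos: "0 < dim_col ?A"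
      by (auto simp: hcat_def cols)
    have "col ?A 0 = ones_vec l"
      using ones_vec_carrier by (simp add: hcat_def cols)
    then show "Q *\<^sub>v (transpose_mat Q *\<^sub>v (Mm *\<^sub>v ones_vec l)) = ones_vec l"
      using gqr_projection_col[OF gqr A Mm pos] by simp
    show "\<exists>s. Q \<in> carrier_mat l s" using gqr_carriers[OF gqr A] by metis
  qed
  obtain s s' where Ub: "Ub \<in> carrier_mat m s" and Vb: "Vb \<in> carrier_mat n s'"
    using range(2)[OF gqrU carriers(1)] range(2)[OF gqrV carriers(2)] by blast
  have Uproj: "Ub *\<^sub>v (transpose_mat Ub *\<^sub>v u) = ones_vec m"
    and Vproj: "Vb *\<^sub>v (transpose_mat Vb *\<^sub>v v) = ones_vec n"
    using range(1)[OF gqrU carriers(1)] range(1)[OF gqrV carriers(2)] by (simp_all add: u_def v_def)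
  have UM: "transpose_mat Ub * Mx \<in> carrier_mat s m" and VM: "transpose_mat Vb * My \<in> carrier_mat s' n"
    using Ub Vb carriers by auto
  \<comment> \<open>Dual form of the projection property: a matrix multiplied by \<open>Ub\<^sup>T * Mx\<close> and tested with \<open>Ub\<^sup>T * u\<close> is in effect tested with \<open>u\<close>.\<close>
  have U_lift: "transpose_mat (transpose_mat Ub * Mx) *\<^sub>v (transpose_mat Ub *\<^sub>v u) = u"
    using transpose_mult_mat_vec[of "transpose_mat Ub" s m Mx m "transpose_mat Ub *\<^sub>v u"] Ub carriers uv_carriers
    by (simp add: symmetric Uproj) (simp add: u_def)
  have V_lift: "transpose_mat (transpose_mat Vb * My) *\<^sub>v (transpose_mat Vb *\<^sub>v v) = v"
    using transpose_mult_mat_vec[of "transpose_mat Vb" s' n My n "transpose_mat Vb *\<^sub>v v"] Vb carriers uv_carriers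
    by (simp add: symmetric Vproj) (simp add: v_def)
  have Sb1: "Sb1 \<in> carrier_mat s s'"
    using Ub Vb U1 V1 S1 carriers by (auto simp: Sb1_def)
  have total_Sb1: "total (Ub * Sb1 * transpose_mat Vb) = total (U1 * S1 * transpose_mat V1)"
  proof -
    have "total (Ub * Sb1 * transpose_mat Vb)
        = scalar_prod (transpose_mat Ub *\<^sub>v u) (Sb1 *\<^sub>v (transpose_mat Vb *\<^sub>v v))"
      by (rule total_factored[OF Ub Sb1 Vb])
    also have "\<dots> = scalar_prod (transpose_mat (transpose_mat Ub * Mx * U1) *\<^sub>v (transpose_mat Ub *\<^sub>v u))
        (S1 *\<^sub>v (transpose_mat (transpose_mat Vb * My * V1) *\<^sub>v (transpose_mat Vb *\<^sub>v v)))"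
      unfolding Sb1_def
      by (rule scalar_prod_mult_transpose) (use Ub Vb U1 V1 S1 carriers uv_carriers in auto)
    also have "transpose_mat (transpose_mat Ub * Mx * U1) *\<^sub>v (transpose_mat Ub *\<^sub>v u) = transpose_mat U1 *\<^sub>v u"
      using transpose_mult_mat_vec[OF UM U1] Ub uv_carriers U_lift by simp
    also have "transpose_mat (transpose_mat Vb * My * V1) *\<^sub>v (transpose_mat Vb *\<^sub>v v) = transpose_mat V1 *\<^sub>v v"
      using transpose_mult_mat_vec[OF VM V1] Vb uv_carriers V_lift by simp
    also have "scalar_prod (transpose_mat U1 *\<^sub>v u) (S1 *\<^sub>v (transpose_mat V1 *\<^sub>v v))
        = total (U1 * S1 * transpose_mat V1)"
      by (rule total_factored[OF U1 S1 V1, symmetric])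
    finally show ?thesis .
  qed
  \<comment> \<open>The Galerkin coefficients of a full matrix.\<close>
  define \<G> where "\<G> X = transpose_mat Ub * Mx * X * My * Vb" for X
  have \<G>_carrier: "\<G> X \<in> carrier_mat s s'" if "X \<in> carrier_mat m n" for X
    using that Ub Vb carriers by (auto simp: \<G>_def)
  have total_\<G>: "scalar_prod (transpose_mat Ub *\<^sub>v u) (\<G> X *\<^sub>v (transpose_mat Vb *\<^sub>v v)) = total X"
    if X: "X \<in> carrier_mat m n" for X
  proof -
    have "\<G> X = (transpose_mat Ub * Mx) * X * transpose_mat (transpose_mat Vb * My)"
      using X Ub Vb carriers UM
      by (simp add: \<G>_def transpose_mult[of _ s' n _ n] symmetric assoc_mult_mat[of _ s n _ n _ s'])
    then have "scalar_prod (transpose_mat Ub *\<^sub>v u) (\<G> X *\<^sub>v (transpose_mat Vb *\<^sub>v v))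
      = scalar_prod (transpose_mat (transpose_mat Ub * Mx) *\<^sub>v (transpose_mat Ub *\<^sub>v u))
        (X *\<^sub>v (transpose_mat (transpose_mat Vb * My) *\<^sub>v (transpose_mat Vb *\<^sub>v v)))"
      using X UM VM Ub Vb uv_carriers by (simp only:) (rule scalar_prod_mult_transpose, auto)
    then show ?thesis by (simp add: U_lift V_lift total_def)
  qed
  have Wb1: "Wb1 \<in> carrier_mat m n" using Ub Sb1 Vb by (auto simp: Wb1_def)
  have G1: "\<G> (N Wb1) \<in> carrier_mat s s'" using \<G>_carrier nonlin_carrier[OF Wb1] by (simp add: N_def)
  have Sb2: "Sb2 \<in> carrier_mat s s'" using Sb1 G1 by (auto simp: Sb2_def \<G>_def)
  have Wb2: "Wb2 \<in> carrier_mat m n" using Ub Sb2 Vb by (auto simp: Wb2_def)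
  have G2: "\<G> (N Wb2) \<in> carrier_mat s s'" using \<G>_carrier nonlin_carrier[OF Wb2] by (simp add: N_def)
  have Sb_carrier: "Sb \<in> carrier_mat s s'" using Sb1 Sb2 G2 by (auto simp: Sb \<G>_def)
  \<comment> \<open>The mass of the full matrix as a function of its Galerkin coefficients.\<close>
  define f where "f Y = scalar_prod (transpose_mat Ub *\<^sub>v u) (Y *\<^sub>v (transpose_mat Vb *\<^sub>v v))" for Y
  have \<alpha>: "transpose_mat Ub *\<^sub>v u \<in> carrier_vec s" "transpose_mat Vb *\<^sub>v v \<in> carrier_vec s'"
    using Ub Vb uv_carriers by auto
  have f_add: "f (X + Y) = f X + f Y" if "X \<in> carrier_mat s s'" "Y \<in> carrier_mat s s'" for X Y
    unfolding f_def by (rule scalar_prod_add_mult_mat_vec[OF that \<alpha>])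
  have f_smult: "f (c \<cdot>\<^sub>m X) = c * f X" if "X \<in> carrier_mat s s'" for c X
    unfolding f_def by (rule scalar_prod_smult_mult_mat_vec[OF that \<alpha>])
  have f_N: "f (\<G> (N Wb1)) = 0" "f (\<G> (N Wb2)) = 0"
    using total_\<G> nonlin_carrier Wb1 Wb2 total_nonlin def1 def2 by (simp_all add: f_def N_def)
  have "f Sb2 = f Sb1"
    using f_add[OF Sb1, of "\<tau> \<cdot>\<^sub>m \<G> (N Wb1)"] f_smult[OF G1] G1 f_N
    unfolding Sb2_def by (simp add: \<G>_def)
  moreover have "Sb = (1/2) \<cdot>\<^sub>m Sb1 + (1/2) \<cdot>\<^sub>m Sb2 + (\<tau>/2) \<cdot>\<^sub>m \<G> (N Wb2)"
    using Sb by (simp add: \<G>_def)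
  ultimately have "f Sb = f Sb1"
    using Sb1 Sb2 G2 f_N by (simp add: f_add f_smult)
  moreover have "total (Ub * Sb * transpose_mat Vb) = f Sb" "total (Ub * Sb1 * transpose_mat Vb) = f Sb1"
    unfolding f_def using total_factored Ub Vb Sb_carrier Sb1 by blast+
  ultimately show ?thesis
    using that[OF Ub Sb_carrier Vb Uproj Vproj] total_Sb1 by simp
qed

text \<open>The mass form in the Galerkin coefficients has the test vectors \<open>Ub\<^sup>T * u\<close> and \<open>Vb\<^sup>T * v\<close>.  Because \<open>Ub\<close> and
  \<open>Vb\<close> reproduce the vectors of ones, their squared norms are the masses of the constant one on the two
  intervals, independently of the mesh and of the rank; their product is \<open>area\<close>.\<close>

lemma truncation_total:
  assumes Ub: "Ub \<in> carrier_mat m s" and Sb: "Sb \<in> carrier_mat s s'" and Vb: "Vb \<in> carrier_mat n s'"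
    and Uproj: "Ub *\<^sub>v (transpose_mat Ub *\<^sub>v u) = ones_vec m"
    and Vproj: "Vb *\<^sub>v (transpose_mat Vb *\<^sub>v v) = ones_vec n"
    and trunc: "truncation \<eta> Ub Sb Vb U S V"
  obtains r where "U \<in> carrier_mat m r" "S \<in> carrier_mat r r" "V \<in> carrier_mat n r"
    "\<bar>total (U * S * transpose_mat V) - total (Ub * Sb * transpose_mat Vb)\<bar> \<le> sqrt area * \<eta>"
proof -
  have dims: "dim_row Sb = s" "dim_col Sb = s'" using Sb by auto
  obtain R \<sigma> P r where r: "r \<le> min s s'" and svd: "is_svd Sb R \<sigma> P"
    and tail: "sqrt (\<Sum>i = r..<min s s'. (\<sigma> i)\<^sup>2) \<le> \<eta>"
    and USV: "S = mat_diag r \<sigma>" "U = Ub * first_cols r R" "V = Vb * first_cols r P"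
    using trunc unfolding truncation_def dims by blast
  have "R \<in> carrier_mat s s" "P \<in> carrier_mat s' s'"
    using svd unfolding is_svd_def Let_def dims by auto
  then have Rr: "first_cols r R \<in> carrier_mat s r" and Pr: "first_cols r P \<in> carrier_mat s' r"
    using first_cols_carrier[of r R] first_cols_carrier[of r P] r by auto
  define \<alpha> where "\<alpha> = transpose_mat Ub *\<^sub>v u"
  define \<beta> where "\<beta> = transpose_mat Vb *\<^sub>v v"
  have \<alpha>: "\<alpha> \<in> carrier_vec s" and \<beta>: "\<beta> \<in> carrier_vec s'"
    using Ub Vb uv_carriers by (auto simp: \<alpha>_def \<beta>_def)
  have carr: "U \<in> carrier_mat m r" "S \<in> carrier_mat r r" "V \<in> carrier_mat n r"
    using Ub Vb Rr Pr by (auto simp: USV)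
  have "total (U * S * transpose_mat V)
      = scalar_prod (transpose_mat (first_cols r R) *\<^sub>v \<alpha>) (S *\<^sub>v (transpose_mat (first_cols r P) *\<^sub>v \<beta>))"
    using total_factored[OF carr] transpose_mult_mat_vec[OF Ub Rr uv_carriers(1)]
      transpose_mult_mat_vec[OF Vb Pr uv_carriers(2)] by (simp add: USV \<alpha>_def \<beta>_def)
  also have "\<dots> = scalar_prod \<alpha> ((first_cols r R * mat_diag r \<sigma> * transpose_mat (first_cols r P)) *\<^sub>v \<beta>)"
    unfolding USV(1) by (rule scalar_prod_mult_transpose[OF Rr mat_diag_dim Pr \<alpha> \<beta>, symmetric])
  finally have truncated: "total (U * S * transpose_mat V) = \<dots>" .
  have full: "total (Ub * Sb * transpose_mat Vb) = scalar_prod \<alpha> (Sb *\<^sub>v \<beta>)"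
    unfolding \<alpha>_def \<beta>_def by (rule total_factored[OF Ub Sb Vb])
  have "scalar_prod \<alpha> \<alpha> = scalar_prod u (Ub *\<^sub>v \<alpha>)"
    unfolding \<alpha>_def by (rule transpose_vec_mult_scalar[OF Ub \<alpha>[unfolded \<alpha>_def] uv_carriers(1)])
  then have norm_\<alpha>: "scalar_prod \<alpha> \<alpha> = scalar_prod (ones_vec m) u"
    using Uproj comm_scalar_prod[OF uv_carriers(1) ones_vec_carrier] by (simp add: \<alpha>_def)
  have "scalar_prod \<beta> \<beta> = scalar_prod v (Vb *\<^sub>v \<beta>)"
    unfolding \<beta>_def by (rule transpose_vec_mult_scalar[OF Vb \<beta>[unfolded \<beta>_def] uv_carriers(2)])
  then have norm_\<beta>: "scalar_prod \<beta> \<beta> = scalar_prod (ones_vec n) v"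
    using Vproj comm_scalar_prod[OF uv_carriers(2) ones_vec_carrier] by (simp add: \<beta>_def)
  have "\<bar>total (U * S * transpose_mat V) - total (Ub * Sb * transpose_mat Vb)\<bar>
      \<le> sqrt (\<Sum>i = r..<min s s'. (\<sigma> i)\<^sup>2) * (sqrt (scalar_prod \<alpha> \<alpha>) * sqrt (scalar_prod \<beta> \<beta>))"
    unfolding truncated full by (rule truncation_form_error[OF svd Sb r \<alpha> \<beta>])
  also have "sqrt (scalar_prod \<alpha> \<alpha>) * sqrt (scalar_prod \<beta> \<beta>) = sqrt area"
    by (simp add: norm_\<alpha> norm_\<beta> area_def real_sqrt_mult)
  also have "sqrt (\<Sum>i = r..<min s s'. (\<sigma> i)\<^sup>2) * sqrt area \<le> \<eta> * sqrt area"
    using tail area_pos by (intro mult_right_mono) auto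
  finally show ?thesis using that[OF carr] by (simp add: mult.commute)
qed

lemma dlr_step_total:
  assumes carr: "U \<in> carrier_mat m p" "S \<in> carrier_mat p q" "V \<in> carrier_mat n q"
    and step: "dlr_step nl area \<epsilon> \<tau> \<eta> Mx My Lx Ly U S V U' S' V'"
  shows "U' * S' * transpose_mat V' \<in> carrier_mat m n"
    and "\<bar>total (U' * S' * transpose_mat V') - total (U * S * transpose_mat V)\<bar> \<le> sqrt area * \<eta>"
proof -
  obtain U1 S1 V1 U2 S2 V2 Ub Sb Vb U3 S3 V3 where
    lin1: "linear_step (\<tau> / 2 * \<epsilon>\<^sup>2) Mx My Lx Ly U S V U1 S1 V1" and
    gal: "galerkin_step nl area \<tau> Mx My U1 S1 V1 U2 S2 V2 Ub Sb Vb" and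
    trunc: "truncation \<eta> Ub Sb Vb U3 S3 V3" and
    lin2: "linear_step (\<tau> / 2 * \<epsilon>\<^sup>2) Mx My Lx Ly U3 S3 V3 U' S' V'"
    using step unfolding dlr_step_def by blast
  obtain p1 q1 where 1: "U1 \<in> carrier_mat m p1" "S1 \<in> carrier_mat p1 q1" "V1 \<in> carrier_mat n q1"
    "total (U1 * S1 * transpose_mat V1) = total (U * S * transpose_mat V)"
    by (rule linear_step_total[OF carr lin1])
  obtain s s' where 2: "Ub \<in> carrier_mat m s" "Sb \<in> carrier_mat s s'" "Vb \<in> carrier_mat n s'"
    "Ub *\<^sub>v (transpose_mat Ub *\<^sub>v u) = ones_vec m" "Vb *\<^sub>v (transpose_mat Vb *\<^sub>v v) = ones_vec n"
    "total (Ub * Sb * transpose_mat Vb) = total (U1 * S1 * transpose_mat V1)"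
    by (rule galerkin_step_total[OF 1(1-3) gal])
  obtain r where 3: "U3 \<in> carrier_mat m r" "S3 \<in> carrier_mat r r" "V3 \<in> carrier_mat n r"
    "\<bar>total (U3 * S3 * transpose_mat V3) - total (Ub * Sb * transpose_mat Vb)\<bar> \<le> sqrt area * \<eta>"
    by (rule truncation_total[OF 2(1-5) trunc])
  obtain p' q' where 4: "U' \<in> carrier_mat m p'" "S' \<in> carrier_mat p' q'" "V' \<in> carrier_mat n q'"
    "total (U' * S' * transpose_mat V') = total (U3 * S3 * transpose_mat V3)"
    by (rule linear_step_total[OF 3(1-3) lin2])
  show "U' * S' * transpose_mat V' \<in> carrier_mat m n" using 4(1-3) by auto
  show "\<bar>total (U' * S' * transpose_mat V') - total (U * S * transpose_mat V)\<bar> \<le> sqrt area * \<eta>"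
    using 1(4) 2(6) 3(4) 4(4) by simp
qed

end

section \<open>Mass as a quadrature\<close>

lemma fe_function_sum:
  assumes "W \<in> carrier_mat m n"
  shows "fe_function \<phi> \<psi> W x y = (\<Sum>i<m. \<Sum>j<n. \<phi> i x * W $$ (i, j) * \<psi> j y)"
  using assms
  by (auto simp: fe_function_def scalar_prod_def atLeast0LessThan sum_distrib_left mult.assoc intro!: sum.cong)

text \<open>Expanding both weight vectors by the row sums of the mass matrices turns the bilinear form into a
  sextuple sum, and exchanging the sums over basis functions with those over quadrature points gives the
  tensor-product quadrature.\<close>

lemma quad2_fe_function:
  assumes X: "lobatto_mesh k \<xi> \<omega> a b M \<phi>" and Y: "lobatto_mesh k \<xi> \<omega> c d N \<psi>"
    and W: "W \<in> carrier_mat (M * k + 1) (N * k + 1)"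
  shows "quad2 k \<xi> \<omega> a b M c d N (fe_function \<phi> \<psi> W) (\<lambda>x y. 1)
    = scalar_prod (mass_matrix k \<xi> \<omega> a b M \<phi> *\<^sub>v ones_vec (M * k + 1))
        (W *\<^sub>v (mass_matrix k \<xi> \<omega> c d N \<psi> *\<^sub>v ones_vec (N * k + 1)))"
proof -
  define m where "m = M * k + 1"
  define n where "n = N * k + 1"
  define u where "u = mass_matrix k \<xi> \<omega> a b M \<phi> *\<^sub>v ones_vec m"
  define v where "v = mass_matrix k \<xi> \<omega> c d N \<psi> *\<^sub>v ones_vec n"
  define wx where "wx i = mesh_size a b M / 2 * \<omega> i" for i
  define wy where "wy j = mesh_size c d N / 2 * \<omega> j" for j
  define x where "x = cell_node \<xi> a b M"
  define y where "y = cell_node \<xi> c d N"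
  have W': "W \<in> carrier_mat m n" using W by (simp add: m_def n_def)
  have u: "vec_index u i = (\<Sum>e<M. \<Sum>l\<le>k. wx l * \<phi> i (x e l))" if "i < m" for i
    using lobatto_mesh.mass_ones_index[OF X] that by (simp add: u_def m_def wx_def x_def)
  have v: "vec_index v j = (\<Sum>e<N. \<Sum>l\<le>k. wy l * \<psi> j (y e l))" if "j < n" for j
    using lobatto_mesh.mass_ones_index[OF Y] that by (simp add: v_def n_def wy_def y_def)
  have uv: "u \<in> carrier_vec m" "v \<in> carrier_vec n"
    unfolding u_def v_def m_def n_def
    using lobatto_mesh.mass_carrier[OF X] lobatto_mesh.mass_carrier[OF Y] by (auto simp: ones_vec_def)
  have prod2: "sum F A * z * sum G B = (\<Sum>e\<in>A. \<Sum>e'\<in>B. F e * z * G e')"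
    for F G :: "nat \<Rightarrow> real" and A B z
    unfolding sum_distrib_right[of F A z] by (rule sum_product)
  have prod4: "(\<Sum>e<M. \<Sum>l\<le>k. f e l) * z * (\<Sum>e'<N. \<Sum>l'\<le>k. g e' l')
      = (\<Sum>e<M. \<Sum>e'<N. \<Sum>l\<le>k. \<Sum>l'\<le>k. f e l * z * g e' l')" for f g and z :: real
    by (simp only: prod2)
  have "scalar_prod u (W *\<^sub>v v) = (\<Sum>i<m. \<Sum>j<n. vec_index u i * W $$ (i, j) * vec_index v j)"
    using W' uv
    by (auto simp: scalar_prod_def atLeast0LessThan sum_distrib_left mult.assoc intro!: sum.cong)
  also have "\<dots> = (\<Sum>i<m. \<Sum>j<n. \<Sum>e<M. \<Sum>e'<N. \<Sum>l\<le>k. \<Sum>l'\<le>k.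
      wx l * \<phi> i (x e l) * W $$ (i, j) * (wy l' * \<psi> j (y e' l')))"
    by (intro sum.cong refl) (simp only: u v lessThan_iff prod4)
  also have "\<dots> = (\<Sum>i<m. \<Sum>e<M. \<Sum>e'<N. \<Sum>l\<le>k. \<Sum>l'\<le>k. \<Sum>j<n.
      wx l * \<phi> i (x e l) * W $$ (i, j) * (wy l' * \<psi> j (y e' l')))"
    \<comment> \<open>Fixing the outer index set orients the exchange: only the sums over basis functions move inwards.\<close>
    by (simp only: sum.swap[of _ _ "{..<n}"])
  also have "\<dots> = (\<Sum>e<M. \<Sum>e'<N. \<Sum>l\<le>k. \<Sum>l'\<le>k. \<Sum>i<m. \<Sum>j<n.
      wx l * \<phi> i (x e l) * W $$ (i, j) * (wy l' * \<psi> j (y e' l')))"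
    by (simp only: sum.swap[of _ _ "{..<m}"])
  also have "\<dots> = (\<Sum>e<M. \<Sum>e'<N. \<Sum>l\<le>k. \<Sum>l'\<le>k. (wx l * wy l') *
      (fe_function \<phi> \<psi> W (x e l) (y e' l') * 1))"
    by (simp add: fe_function_sum[OF W'] sum_distrib_left ac_simps)
  also have "\<dots> = quad2 k \<xi> \<omega> a b M c d N (fe_function \<phi> \<psi> W) (\<lambda>x y. 1)"
    by (simp add: quad2_def wx_def wy_def x_def y_def)
  finally show ?thesis by (simp add: u_def v_def m_def n_def)
qed

lemma quad2_diff:
  "quad2 k \<xi> \<omega> a b M c d N (\<lambda>x y. f x y - g x y) h
    = quad2 k \<xi> \<omega> a b M c d N f h - quad2 k \<xi> \<omega> a b M c d N g h"
  unfolding quad2_def by (simp add: left_diff_distrib right_diff_distrib sum_subtractf)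

section \<open>Conservation of mass up to the truncation tolerance\<close>

theorem theorem3p2:
  fixes a b c d \<epsilon> :: real and k :: nat and \<xi> \<omega> :: "nat \<Rightarrow> real" and nl :: nonlinearity
  assumes "a < b" and "c < d" and "k \<ge> 1" and "\<epsilon> > 0" and "gauss_lobatto k \<xi> \<omega>"
  shows "\<exists>C>0. \<forall>(M::nat) (N::nat) (r::nat) (\<tau>::real) (\<eta>::real)
      (\<phi> :: nat \<Rightarrow> real \<Rightarrow> real) (\<psi> :: nat \<Rightarrow> real \<Rightarrow> real)
      (U :: real mat) (S :: real mat) (V :: real mat)
      (U' :: real mat) (S' :: real mat) (V' :: real mat).
    let m = M * k + 1; n = N * k + 1;
        Mx = mass_matrix k \<xi> \<omega> a b M \<phi>;
        My = mass_matrix k \<xi> \<omega> c d N \<psi>;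
        Lx = discrete_laplacian k \<xi> \<omega> a b M \<phi>;
        Ly = discrete_laplacian k \<xi> \<omega> c d N \<psi>;
        area = (b - a) * (d - c);
        I = ones_mat m n;
        W = U * S * transpose_mat V;
        W' = U' * S' * transpose_mat V';
        w = fe_function \<phi> \<psi> W;
        w' = fe_function \<phi> \<psi> W'
    in
      M \<ge> 1 \<and> N \<ge> 1 \<and> \<tau> > 0 \<and> \<eta> \<ge> 0 \<and>
      nodal_basis k \<xi> a b M \<phi> \<and> nodal_basis k \<xi> c d N \<psi> \<and>
      U \<in> carrier_mat m r \<and> S \<in> carrier_mat r r \<and> V \<in> carrier_mat n r \<and>
      transpose_mat U * Mx * U = 1\<^sub>m r \<and> transpose_mat V * My * V = 1\<^sub>m r \<and>
      dlr_step nl area \<epsilon> \<tau> \<eta> Mx My Lx Ly U S V U' S' V'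
      \<longrightarrow>
      \<bar>quad2 k \<xi> \<omega> a b M c d N (\<lambda>x y. w' x y - w x y) (\<lambda>x y. 1)\<bar>
        = \<bar>mass_inner Mx My W' I - mass_inner Mx My W I\<bar> \<and>
      \<bar>mass_inner Mx My W' I - mass_inner Mx My W I\<bar>
        = \<bar>mass_inner Mx My (U' * S' * transpose_mat V') I
            - mass_inner Mx My (U * S * transpose_mat V) I\<bar> \<and>
      \<bar>mass_inner Mx My (U' * S' * transpose_mat V') I
            - mass_inner Mx My (U * S * transpose_mat V) I\<bar> \<le> C * \<eta>"
  unfolding Let_def
proof (intro exI[of _ "sqrt ((b - a) * (d - c))"] conjI[OF _ allI] allI impI, goal_cases)
  case 1
  show ?case using assms by simp
next
  case (2 M N r \<tau> \<eta> \<phi> \<psi> U S V U' S' V')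
  let ?m = "M * k + 1" and ?n = "N * k + 1"
  let ?Mx = "mass_matrix k \<xi> \<omega> a b M \<phi>" and ?My = "mass_matrix k \<xi> \<omega> c d N \<psi>"
  let ?Lx = "discrete_laplacian k \<xi> \<omega> a b M \<phi>" and ?Ly = "discrete_laplacian k \<xi> \<omega> c d N \<psi>"
  let ?W = "U * S * transpose_mat V" and ?W' = "U' * S' * transpose_mat V'"
  have step: "dlr_step nl ((b - a) * (d - c)) \<epsilon> \<tau> \<eta> ?Mx ?My ?Lx ?Ly U S V U' S' V'"
    and carr: "U \<in> carrier_mat ?m r" "S \<in> carrier_mat r r" "V \<in> carrier_mat ?n r"
    using 2 by blast+
  interpret X: lobatto_mesh k \<xi> \<omega> a b M \<phi>
    using 2 assms by unfold_locales auto
  interpret Y: lobatto_mesh k \<xi> \<omega> c d N \<psi>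
    using 2 assms by unfold_locales auto
  interpret scheme: conservative_scheme ?m ?n ?Mx ?My ?Lx ?Ly
    using assms
    by unfold_locales
      (simp_all only: X.mass_carrier Y.mass_carrier X.laplacian_carrier Y.laplacian_carrier
        X.transpose_mass Y.transpose_mass X.transpose_laplacian_mass_ones
        Y.transpose_laplacian_mass_ones X.ones_mass_ones Y.ones_mass_ones diff_gt_0_iff_gt)
  have area: "scheme.area = (b - a) * (d - c)"
    unfolding scheme.area_def scheme.u_def scheme.v_def X.ones_mass_ones Y.ones_mass_ones ..
  have W: "?W \<in> carrier_mat ?m ?n" using carr by auto
  have W': "?W' \<in> carrier_mat ?m ?n"
    and bound: "\<bar>scheme.total ?W' - scheme.total ?W\<bar> \<le> sqrt ((b - a) * (d - c)) * \<eta>"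
    using scheme.dlr_step_total[OF carr, of nl \<epsilon> \<tau> \<eta>] step unfolding area by blast+
  have quad: "quad2 k \<xi> \<omega> a b M c d N (fe_function \<phi> \<psi> Z) (\<lambda>x y. 1) = scheme.total Z"
    if "Z \<in> carrier_mat ?m ?n" for Z
    unfolding scheme.total_def scheme.u_def scheme.v_def
    by (rule quad2_fe_function[OF X.lobatto_mesh_axioms Y.lobatto_mesh_axioms that])
  show ?case
    unfolding quad2_diff quad[OF W] quad[OF W'] scheme.mass_inner_eq_total[OF W]
      scheme.mass_inner_eq_total[OF W']
    using bound by simp
qed

end
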